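(* Let $F \subset \mathbb{R}^d$ be a self-conformal set and $s=\dim_{\mathrm{H}}(F)$. Then there exists a constant $C \ge 1$ such that $$\mathcal{H}^s(F \cap A) \le C\,\mathcal{H}^s_\infty(F\cap A)$$ for all $A \subset \mathbb{R}^d$. Furthermore, $\mathcal{H}^s(F)>0$ if and only if $F$ is Ahlfors $s$-regular.
   Context: Conformal maps and self-conformal sets: let $\Omega \subset \mathbb{R}^d$ be open. A $C^1$-mapping $\varphi \colon \Omega \to \mathbb{R}^d$ is conformal if for every $x\in\Omega$ the differential $\varphi'(x)$ is a similarity, i.e. $|\varphi'(x)y| = |\varphi'(x)||y| \ne 0$ for all $y \in \mathbb{R}^d \setminus \{0\}$ (where $|\varphi'(x)|$ is the operator norm), and $x \mapsto \varphi'(x)$ is Hölder continuous: there exist $\alpha,c>0$ with $|\varphi'(x) - \varphi'(y)| \le c|x-y|^\alpha$ for all $x,y \in \Omega$. (For $d=1$ these are the $C^{1+\alpha}$-functions with non-vanishing derivative.) A finite family $\{\varphi_i\}_{i=1}^N$, $N \ge 2$, is a conformal iterated function system if each $\varphi_i$ is an injective conformal mapping on a common non-empty bounded open convex set $\Omega \subset \mathbb{R}^d$ such that $\overline{\varphi_i(\Omega)} \subset \Omega$ and $\|\varphi_i'\| := \sup_{x \in \Omega}|\varphi_i'(x)| < 1$. The associated self-conformal set is the unique non-empty compact set $F \subset \Omega$ with $F = \bigcup_{i=1}^N \varphi_i(F)$. Hausdorff measure and content: for $0<\delta\le\infty$, $\mathcal{H}^s_\delta(A) = \inf\{ \sum_i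 \operatorname{diam}(U_i)^s : A \subset \bigcup_i U_i,\ \operatorname{diam}(U_i) \le \delta \}$ (countable covers), $\mathcal{H}^s(A) = \lim_{\delta \downarrow 0} \mathcal{H}^s_\delta(A)$, and $\dim_{\mathrm{H}}(A)=\inf\{s:\mathcal{H}^s(A)=0\}$. Ahlfors regularity: $A \subset \mathbb{R}^d$ is Ahlfors $s$-regular if there exist a Radon measure $\mu$ supported on $A$ and a constant $C \ge 1$ such that $C^{-1}r^s \le \mu(B(x,r)) \le Cr^s$ for all $x \in A$ and $0<r<\operatorname{diam}(A)$, where $B(x,r)$ is the closed ball. *)

theory Defs
  imports "HOL-Analysis.Analysis"
begin

section \<open>Self-conformal sets\<close>

text \<open>The differential as a bounded linear operator, so that \<open>norm\<close> is the operator norm. It is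
  used only at points of an open set on which the map is differentiable; there it depends only on
  the restriction of the map to that set.\<close>

definition differential ::
    "('a::euclidean_space \<Rightarrow> 'a) \<Rightarrow> 'a \<Rightarrow> 'a \<Rightarrow>\<^sub>L 'a" where
  "differential \<phi> x = Blinfun (frechet_derivative \<phi> (at x))"

definition conformal_on :: "'a::euclidean_space set \<Rightarrow> ('a \<Rightarrow> 'a) \<Rightarrow> bool" where
  "conformal_on \<Omega> \<phi> \<longleftrightarrow>
     open \<Omega> \<and>
     (\<forall>x\<in>\<Omega>. \<phi> differentiable (at x)) \<and>
     continuous_on \<Omega> (differential \<phi>) \<and>
     (\<forall>x\<in>\<Omega>. \<forall>y. y \<noteq> 0 \<longrightarrow>
        norm (blinfun_apply (differential \<phi> x) y) = norm (differential \<phi> x) * norm y \<and>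
        norm (differential \<phi> x) * norm y \<noteq> 0) \<and>
     (\<exists>\<alpha>>0. \<exists>c>0. \<forall>x\<in>\<Omega>. \<forall>y\<in>\<Omega>.
        norm (differential \<phi> x - differential \<phi> y) \<le> c * norm (x - y) powr \<alpha>)"

definition differential_sup_norm :: "'a::euclidean_space set \<Rightarrow> ('a \<Rightarrow> 'a) \<Rightarrow> ennreal" where
  "differential_sup_norm \<Omega> \<phi> = (SUP x\<in>\<Omega>. ennreal (norm (differential \<phi> x)))"

definition conformal_ifs ::
    "'a::euclidean_space set \<Rightarrow> nat \<Rightarrow> (nat \<Rightarrow> 'a \<Rightarrow> 'a) \<Rightarrow> bool" where
  "conformal_ifs \<Omega> N \<phi> \<longleftrightarrow>
     2 \<le> N \<and> \<Omega> \<noteq> {} \<and> bounded \<Omega> \<and> open \<Omega> \<and> convex \<Omega> \<and>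
     (\<forall>i\<in>{1..N}. conformal_on \<Omega> (\<phi> i) \<and> inj_on (\<phi> i) \<Omega> \<and>
        closure (\<phi> i ` \<Omega>) \<subseteq> \<Omega> \<and> differential_sup_norm \<Omega> (\<phi> i) < 1)"

text \<open>By Hutchinson's theorem a conformal iterated function system has exactly one non-empty
  compact invariant set contained in \<open>\<Omega>\<close>, so these properties determine \<open>F\<close>.\<close>

definition self_conformal_set :: "'a::euclidean_space set \<Rightarrow> bool" where
  "self_conformal_set F \<longleftrightarrow>
     (\<exists>\<Omega> N \<phi>. conformal_ifs \<Omega> N \<phi> \<and>
        F \<noteq> {} \<and> compact F \<and> F \<subseteq> \<Omega> \<and> F = (\<Union>i\<in>{1..N}. \<phi> i ` F))"

section \<open>Hausdorff measure, content and dimension\<close>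

text \<open>The library's \<open>diameter\<close> is meaningful for bounded sets only.\<close>

definition ediameter :: "'a::metric_space set \<Rightarrow> ennreal" where
  "ediameter U = (if bounded U then ennreal (diameter U) else \<infinity>)"

text \<open>The usual conventions for \<open>s = 0\<close>: the empty set contributes \<open>0\<close>, every other set
  contributes \<open>1\<close>, so that the measure for \<open>s = 0\<close> is counting measure. They have to be spelled
  out because \<open>0 powr 0 = 0\<close>.\<close>

definition diam_pow :: "real \<Rightarrow> 'a::metric_space set \<Rightarrow> ennreal" where
  "diam_pow s U =
     (if U = {} then 0
      else if s = 0 then 1
      else if bounded U then ennreal (diameter U powr s)
      else \<infinity>)"

text \<open>Finite covers are included, since they can be padded with empty sets.\<close>

definition hausdorff_content :: "real \<Rightarrow> ennreal \<Rightarrow> 'a::metric_space set \<Rightarrow> ennreal" where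
  "hausdorff_content s \<delta> A =
     (INF U\<in>{U :: nat \<Rightarrow> 'a set. A \<subseteq> (\<Union>i. U i) \<and> (\<forall>i. ediameter (U i) \<le> \<delta>)}.
        \<Sum>i. diam_pow s (U i))"

definition hausdorff_measure :: "real \<Rightarrow> 'a::metric_space set \<Rightarrow> ennreal" where
  "hausdorff_measure s A = Lim (at_right (0::real)) (\<lambda>\<delta>. hausdorff_content s (ennreal \<delta>) A)"

lemma hausdorff_content_antimono:
  assumes "\<delta> \<le> \<delta>'"
  shows "hausdorff_content s \<delta>' A \<le> hausdorff_content s \<delta> A"
  unfolding hausdorff_content_def
  by (rule INF_superset_mono) (use assms in \<open>auto intro: order_trans\<close>)

lemma hausdorff_content_tendsto_SUP:
  "((\<lambda>\<delta>. hausdorff_content s (ennreal \<delta>) A) \<longlongrightarrow>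
     (SUP \<delta>\<in>{0<..}. hausdorff_content s (ennreal \<delta>) A)) (at_right (0::real))"
proof (rule order_tendstoI)
  fix a assume "a < (SUP \<delta>\<in>{0<..}. hausdorff_content s (ennreal \<delta>) A)"
  then obtain d :: real where d: "d > 0" "a < hausdorff_content s (ennreal d) A"
    by (auto simp: less_SUP_iff)
  have "eventually (\<lambda>x::real. x < d) (at_right 0)"
    using d(1) eventually_at_right_field by blast
  then show "eventually (\<lambda>x. a < hausdorff_content s (ennreal x) A) (at_right (0::real))"
    by eventually_elim
      (meson d(2) ennreal_leI hausdorff_content_antimono less_imp_le order_less_le_trans)
next
  fix a assume a: "(SUP \<delta>\<in>{0<..}. hausdorff_content s (ennreal \<delta>) A) < a"
  show "eventually (\<lambda>x. hausdorff_content s (ennreal x) A < a) (at_right (0::real))"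
    using eventually_at_right_less
  proof eventually_elim
    case (elim x)
    then have "hausdorff_content s (ennreal x) A
        \<le> (SUP \<delta>\<in>{0<..}. hausdorff_content s (ennreal \<delta>) A)"
      by (intro SUP_upper) auto
    then show ?case
      using a by (rule order_le_less_trans)
  qed
qed

lemma hausdorff_measure_eq_SUP:
  "hausdorff_measure s A = (SUP \<delta>\<in>{0<..}. hausdorff_content s (ennreal \<delta>) A)"
  unfolding hausdorff_measure_def
  by (rule tendsto_Lim[OF _ hausdorff_content_tendsto_SUP]) simp

text \<open>In a Euclidean space the set of exponents below is non-empty, because every exponent larger
  than the dimension of the space belongs to it. The real infimum is therefore the true one.\<close>

definition hausdorff_dim :: "'a::euclidean_space set \<Rightarrow> real" where
  "hausdorff_dim A = Inf {s. 0 \<le> s \<and> hausdorff_measure s A = 0}"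

section \<open>Ahlfors regularity\<close>

definition radon_measure :: "'a::euclidean_space measure \<Rightarrow> bool" where
  "radon_measure \<mu> \<longleftrightarrow>
     sets \<mu> = sets borel \<and>
     (\<forall>K. compact K \<longrightarrow> emeasure \<mu> K < \<infinity>) \<and>
     (\<forall>V. open V \<longrightarrow> emeasure \<mu> V = (SUP K\<in>{K. K \<subseteq> V \<and> compact K}. emeasure \<mu> K)) \<and>
     (\<forall>B\<in>sets borel. emeasure \<mu> B = (INF V\<in>{V. B \<subseteq> V \<and> open V}. emeasure \<mu> V))"

text \<open>The measure being supported on \<open>A\<close> is expressed by the complement of \<open>A\<close> being contained
  in a null set; for closed \<open>A\<close> this says that the topological support lies in \<open>A\<close>.\<close>

definition ahlfors_regular :: "real \<Rightarrow> 'a::euclidean_space set \<Rightarrow> bool" where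
  "ahlfors_regular s A \<longleftrightarrow>
     (\<exists>\<mu> :: 'a measure. \<exists>C::real.
        radon_measure \<mu> \<and> (AE x in \<mu>. x \<in> A) \<and> 1 \<le> C \<and>
        (\<forall>x\<in>A. \<forall>r::real. 0 < r \<and> ennreal r < ediameter A \<longrightarrow>
           ennreal (inverse C * r powr s) \<le> emeasure \<mu> (cball x r) \<and>
           emeasure \<mu> (cball x r) \<le> ennreal (C * r powr s)))"

end

theory Submission
  imports Defs
begin

text \<open>
  Bounded distortion of the iterates makes \<open>F\<close> quasi self-similar: every point of \<open>F\<close> lies, at every
  scale \<open>r \<le> 1\<close>, in a subset of \<open>F\<close> that is an image of \<open>F\<close> under a similarity of ratio \<open>r\<close> up to
  bounded factors. Only distances between points of \<open>F\<close> are distorted, so the iterates are never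
  inverted off \<open>F\<close>; convexity of \<open>\<Omega>\<close> enters through the linearization of a single map.

  If many separated copies of \<open>F\<close> of one size \<open>b\<close> satisfy \<open>card * b powr t \<ge> 1\<close>, the Cantor set that they
  generate gives \<open>hausdorff_measure t F > 0\<close>. Hence \<open>s > 0\<close> when \<open>F\<close> has two points, and
  \<open>hausdorff_measure s F < \<infinity>\<close>: otherwise there would be enough copies to increase the exponent.

  The central estimate is \<open>hausdorff_measure s (F \<inter> U) \<le> C * diameter U powr s\<close>. If some compact \<open>E \<subseteq> F\<close>
  had too large a measure for its diameter, then replacing the copies of \<open>E\<close> inside \<open>F\<close> at a small
  scale by single covering sets would reduce the cost of covering \<open>F\<close> by a fixed proportion, at
  every scale, below its Hausdorff measure. The estimate gives the comparison with the content and
  the upper Ahlfors bound; the lower one comes from the copies of \<open>F\<close>.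
\<close>

section \<open>Hausdorff content and measure\<close>

text \<open>The pieces of \<open>F\<close> may overlap, since no separation condition is imposed on
  the system; so the pieces of one generation can be neither counted nor added up. They are replaced
  by a maximal packing of \<open>F\<close> at distance \<open>3 * (K * r * D)\<close> with one copy
  of \<open>F\<close> through each centre. These copies are disjoint, and their number N also
  controls \<open>F\<close> from above, because the balls of the packing cover \<open>F\<close>. The
  content of \<open>F\<close> at a scale comparable to r is thus at most a constant times N * r^s,
  while each of the N copies saves a constant times r^s if the central estimate fails. The ratio of
  the two constants does not depend on r; this is why the gain is a fixed proportion and survives r
  -> 0. Savings are differences of measures, so finiteness of the measure has to be known before.
  Splitting off the copies exactly needs measurable sets, hence the compact \<open>E\<close> and the
  Caratheodory construction. The comparison constant comes out as \<open>(K / a) powr s\<close>.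
  One-point sets, where s = 0 and covering sets are merely counted, are treated directly at the
  end.\<close>

lemma diam_pow_empty [simp]: "diam_pow s {} = 0"
  by (simp add: diam_pow_def)

lemma ediameter_empty [simp]: "ediameter {} = 0"
  by (simp add: ediameter_def)

lemma diam_pow_pos:
  assumes "0 < s"
  shows "diam_pow s U = (if bounded U then ennreal (diameter U powr s) else \<infinity>)"
  using assms by (auto simp: diam_pow_def)

lemma hausdorff_content_le:
  assumes "A \<subseteq> (\<Union>i. U i)" "\<And>i. ediameter (U i) \<le> \<delta>"
  shows "hausdorff_content s \<delta> A \<le> (\<Sum>i. diam_pow s (U i))"
  unfolding hausdorff_content_def by (rule INF_lower2[of U]) (use assms in auto)

lemma hausdorff_content_ge:
  assumes "\<And>U. A \<subseteq> (\<Union>i. U i) \<Longrightarrow> (\<And>i. ediameter (U i) \<le> \<delta>) \<Longrightarrow> b \<le> (\<Sum>i. diam_pow s (U i))"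
  shows "b \<le> hausdorff_content s \<delta> A"
  unfolding hausdorff_content_def by (rule INF_greatest) (use assms in auto)

lemma hausdorff_content_coverE:
  assumes "hausdorff_content s \<delta> A < b"
  obtains U :: "nat \<Rightarrow> 'a::metric_space set"
    where "A \<subseteq> (\<Union>i. U i)" "\<And>i. ediameter (U i) \<le> \<delta>" "(\<Sum>i. diam_pow s (U i)) < b"
  using assms unfolding hausdorff_content_def by (auto simp: INF_less_iff)

lemma hausdorff_content_mono:
  assumes "A \<subseteq> B"
  shows "hausdorff_content s \<delta> A \<le> hausdorff_content s \<delta> B"
  unfolding hausdorff_content_def by (rule INF_superset_mono) (use assms in auto)

lemma hausdorff_content_le_diam_pow:
  assumes "ediameter A \<le> \<delta>"
  shows "hausdorff_content s \<delta> A \<le> diam_pow s A"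
proof -
  have "hausdorff_content s \<delta> A \<le> (\<Sum>i. diam_pow s (if i = (0::nat) then A else {}))"
    by (rule hausdorff_content_le) (use assms in auto)
  also have "\<dots> = (\<Sum>i\<in>{0}. diam_pow s (if i = (0::nat) then A else {}))"
    by (rule suminf_finite) auto
  finally show ?thesis by simp
qed

lemma hausdorff_content_empty [simp]: "hausdorff_content s \<delta> {} = 0"
  using hausdorff_content_le_diam_pow[of "{}" \<delta> s] by simp

lemma hausdorff_content_Union_nat:
  fixes A :: "nat \<Rightarrow> 'a::metric_space set"
  shows "hausdorff_content s \<delta> (\<Union>n. A n) \<le> (\<Sum>n. hausdorff_content s \<delta> (A n))"
proof (rule ennreal_le_epsilon)
  fix e :: real assume fin: "(\<Sum>n. hausdorff_content s \<delta> (A n)) < top" and e: "0 < e"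
  have "\<exists>U. A n \<subseteq> (\<Union>i. U i) \<and> (\<forall>i. ediameter (U i) \<le> \<delta>) \<and>
      (\<Sum>i. diam_pow s (U i :: 'a set)) \<le> hausdorff_content s \<delta> (A n) + ennreal (e * (1/2)^Suc n)" for n
  proof -
    have "hausdorff_content s \<delta> (A n) < top"
      using fin by (meson ennreal_suminf_lessD)
    then have "hausdorff_content s \<delta> (A n) < hausdorff_content s \<delta> (A n) + ennreal (e * (1/2)^Suc n)"
      using e by simp
    then show ?thesis
      by (elim hausdorff_content_coverE) (metis less_imp_le)
  qed
  then obtain U where U: "\<And>n. A n \<subseteq> (\<Union>i. U n i)" "\<And>n i. ediameter (U n i) \<le> \<delta>"
    "\<And>n. (\<Sum>i. diam_pow s (U n i :: 'a set)) \<le> hausdorff_content s \<delta> (A n) + ennreal (e * (1/2)^Suc n)"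
    by metis
  have "hausdorff_content s \<delta> (\<Union>n. A n) \<le> (\<Sum>k. diam_pow s (case prod_decode k of (n, i) \<Rightarrow> U n i))"
  proof (rule hausdorff_content_le)
    show "(\<Union>n. A n) \<subseteq> (\<Union>k. case prod_decode k of (n, i) \<Rightarrow> U n i)"
    proof
      fix x assume "x \<in> (\<Union>n. A n)"
      then obtain n i where "x \<in> U n i" using U(1) by blast
      then show "x \<in> (\<Union>k. case prod_decode k of (n, i) \<Rightarrow> U n i)"
        by (intro UN_I[of "prod_encode (n, i)"]) auto
    qed
  qed (auto simp: U(2) split: prod.split)
  also have "\<dots> = (\<Sum>n. \<Sum>i. diam_pow s (U n i))"
    by (rule suminf_ennreal_2dimen) (auto simp: case_prod_beta)
  also have "\<dots> \<le> (\<Sum>n. hausdorff_content s \<delta> (A n) + ennreal (e * (1/2)^Suc n))"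
    by (intro suminf_le U(3)) auto
  also have "\<dots> = (\<Sum>n. hausdorff_content s \<delta> (A n)) + (\<Sum>n. ennreal (e * (1/2)^Suc n))"
    by (rule suminf_add[symmetric]) auto
  also have "(\<Sum>n. ennreal (e * (1/2)^Suc n)) = ennreal e"
  proof (rule suminf_ennreal_eq)
    have "(\<lambda>n. (1/2::real)^Suc n) sums 1"
      by (rule power_half_series)
    from sums_mult[OF this, of e] show "(\<lambda>n. e * (1/2)^Suc n) sums e" by simp
  qed (use e in auto)
  finally show "hausdorff_content s \<delta> (\<Union>n. A n) \<le> (\<Sum>n. hausdorff_content s \<delta> (A n)) + ennreal e" .
qed

lemma hausdorff_content_Un:
  "hausdorff_content s \<delta> (A \<union> B) \<le> hausdorff_content s \<delta> A + hausdorff_content s \<delta> B"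
proof -
  have "hausdorff_content s \<delta> (\<Union>n. binaryset A B n) \<le> (\<Sum>n. hausdorff_content s \<delta> (binaryset A B n))"
    by (rule hausdorff_content_Union_nat)
  also have "\<dots> = hausdorff_content s \<delta> A + hausdorff_content s \<delta> B"
    by (rule suminf_binaryset_eq) simp
  finally show ?thesis by (simp add: UN_binaryset_eq)
qed

lemma hausdorff_content_UN_finite:
  assumes "finite T"
  shows "hausdorff_content s \<delta> (\<Union>t\<in>T. A t) \<le> (\<Sum>t\<in>T. hausdorff_content s \<delta> (A t))"
  using assms
proof induction
  case (insert t T)
  have "hausdorff_content s \<delta> (\<Union>t\<in>insert t T. A t)
      \<le> hausdorff_content s \<delta> (A t) + hausdorff_content s \<delta> (\<Union>t\<in>T. A t)"
    using hausdorff_content_Un[of s \<delta> "A t"] by simp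
  also have "\<dots> \<le> hausdorff_content s \<delta> (A t) + (\<Sum>t\<in>T. hausdorff_content s \<delta> (A t))"
    by (intro add_left_mono insert.IH)
  finally show ?case using insert by simp
qed simp

lemma diameter_leI:
  fixes S :: "'a::metric_space set"
  assumes "0 \<le> \<delta>" "\<And>x y. x \<in> S \<Longrightarrow> y \<in> S \<Longrightarrow> dist x y \<le> \<delta>"
  shows "diameter S \<le> \<delta>"
  using assms by (auto simp: diameter_def intro: cSUP_least)

lemma diameter_image_le:
  fixes f :: "'a::metric_space \<Rightarrow> 'b::metric_space"
  assumes "bounded U" "0 \<le> L" "\<And>x y. x \<in> U \<Longrightarrow> y \<in> U \<Longrightarrow> dist (f x) (f y) \<le> L * dist x y"
  shows "bounded (f ` U)" "diameter (f ` U) \<le> L * diameter U"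
proof -
  have *: "dist (f x) (f y) \<le> L * diameter U" if "x \<in> U" "y \<in> U" for x y
    using assms that diameter_bounded_bound[OF assms(1) that]
    by (meson mult_left_mono order_trans)
  show "bounded (f ` U)"
    unfolding bounded_two_points using * by blast
  show "diameter (f ` U) \<le> L * diameter U"
    by (rule diameter_leI) (use * assms diameter_ge_0[OF assms(1)] in auto)
qed

text \<open>Each covering set is first cut down to \<open>A\<close>, because \<open>f\<close> is
  controlled only there; its image is then at most \<open>L\<close> times as wide. Relating the
  scales by \<open>ennreal L * \<delta> \<le> \<delta>'\<close> treats finite and infinite scales
  alike.\<close>

lemma hausdorff_content_lipschitz_image:
  fixes f :: "'a::metric_space \<Rightarrow> 'b::metric_space"
  assumes s: "0 < s" and L: "0 < L" and d: "ennreal L * \<delta> \<le> \<delta>'"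
    and f: "\<And>x y. x \<in> A \<Longrightarrow> y \<in> A \<Longrightarrow> dist (f x) (f y) \<le> L * dist x y"
  shows "hausdorff_content s \<delta>' (f ` A) \<le> ennreal (L powr s) * hausdorff_content s \<delta> A"
proof -
  have inv: "ennreal (L powr s) * ennreal (1 / L powr s) = 1"
    using L by (simp flip: ennreal_mult)
  \<comment> \<open>The bound by an infimum over covers needs the content alone on the right, so the
    constant is first moved to the left as its reciprocal.\<close>
  have "ennreal (1 / L powr s) * hausdorff_content s \<delta>' (f ` A) \<le> hausdorff_content s \<delta> A"
  proof (rule hausdorff_content_ge)
    fix U :: "nat \<Rightarrow> 'a set"
    assume U: "A \<subseteq> (\<Union>i. U i)" "\<And>i. ediameter (U i) \<le> \<delta>"
    define V where "V i = f ` (A \<inter> U i)" for i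
    have V: "bounded (V i)" "diameter (V i) \<le> L * diameter (U i)" if "bounded (U i)" for i
    proof -
      have b: "bounded (A \<inter> U i)" using that by (rule bounded_subset) auto
      show "bounded (V i)" unfolding V_def
        by (rule diameter_image_le(1)[OF b, of L]) (use L f in auto)
      have "diameter (V i) \<le> L * diameter (A \<inter> U i)" unfolding V_def
        by (rule diameter_image_le(2)[OF b, of L]) (use L f in auto)
      also have "\<dots> \<le> L * diameter (U i)"
        using L that by (intro mult_left_mono diameter_subset) auto
      finally show "diameter (V i) \<le> L * diameter (U i)" .
    qed
    have "hausdorff_content s \<delta>' (f ` A) \<le> (\<Sum>i. diam_pow s (V i))"
    proof (rule hausdorff_content_le)
      show "f ` A \<subseteq> (\<Union>i. V i)" using U(1) unfolding V_def by blast
      show "ediameter (V i) \<le> \<delta>'" for i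
      proof -
        have "ediameter (V i) \<le> ennreal L * ediameter (U i)"
          using V[of i] L unfolding ediameter_def
          by (auto simp: ennreal_mult_top diameter_ge_0 simp flip: ennreal_mult intro!: ennreal_leI)
        also have "\<dots> \<le> ennreal L * \<delta>" by (intro mult_left_mono U(2)) auto
        finally show ?thesis using d by simp
      qed
    qed
    also have "\<dots> \<le> (\<Sum>i. ennreal (L powr s) * diam_pow s (U i))"
    proof (rule suminf_le)
      show "diam_pow s (V i) \<le> ennreal (L powr s) * diam_pow s (U i)" for i
      proof (cases "bounded (U i)")
        case True
        have "diameter (V i) powr s \<le> (L * diameter (U i)) powr s"
          using s V[OF True] by (intro powr_mono2 diameter_ge_0) auto
        also have "\<dots> = L powr s * diameter (U i) powr s"
          using L True by (simp add: powr_mult diameter_ge_0)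
        finally show ?thesis using True V[OF True] s
          by (simp add: diam_pow_pos ennreal_leI flip: ennreal_mult)
      next
        case False
        then show ?thesis using s L by (simp add: diam_pow_pos ennreal_mult_top)
      qed
    qed auto
    also have "\<dots> = ennreal (L powr s) * (\<Sum>i. diam_pow s (U i))" by simp
    finally have "ennreal (1 / L powr s) * hausdorff_content s \<delta>' (f ` A)
        \<le> ennreal (1 / L powr s) * (ennreal (L powr s) * (\<Sum>i. diam_pow s (U i)))"
      by (intro mult_left_mono) auto
    also have "\<dots> = (\<Sum>i. diam_pow s (U i))"
      using inv by (metis mult.assoc mult.commute mult_1)
    finally show "ennreal (1 / L powr s) * hausdorff_content s \<delta>' (f ` A) \<le> (\<Sum>i. diam_pow s (U i))" .
  qed
  then have "ennreal (L powr s) * (ennreal (1 / L powr s) * hausdorff_content s \<delta>' (f ` A))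
      \<le> ennreal (L powr s) * hausdorff_content s \<delta> A"
    by (intro mult_left_mono) auto
  then show ?thesis
    using inv by (metis mult.assoc mult_1)
qed

section \<open>From content to measure: scaling, separated sets, change of exponent\<close>

lemma hausdorff_content_le_measure:
  assumes "0 < \<delta>"
  shows "hausdorff_content s \<delta> A \<le> hausdorff_measure s A"
proof (cases \<delta>)
  case (real d)
  then show ?thesis using assms unfolding hausdorff_measure_eq_SUP
    by (intro SUP_upper2[of d]) auto
next
  case top
  have "hausdorff_content s \<delta> A \<le> hausdorff_content s (ennreal 1) A"
    by (rule hausdorff_content_antimono) (simp add: top)
  also have "\<dots> \<le> hausdorff_measure s A" unfolding hausdorff_measure_eq_SUP
    by (intro SUP_upper) auto
  finally show ?thesis .
qed

lemma hausdorff_measure_leI: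
  assumes "\<And>\<delta>::real. 0 < \<delta> \<Longrightarrow> hausdorff_content s (ennreal \<delta>) A \<le> b"
  shows "hausdorff_measure s A \<le> b"
  unfolding hausdorff_measure_eq_SUP by (rule SUP_least) (use assms in auto)

lemma hausdorff_measure_empty [simp]: "hausdorff_measure s {} = 0"
  using hausdorff_measure_leI[of s "{}" 0] by simp

lemma hausdorff_measure_mono:
  "A \<subseteq> B \<Longrightarrow> hausdorff_measure s A \<le> hausdorff_measure s B"
  unfolding hausdorff_measure_eq_SUP by (intro SUP_mono) (auto intro: hausdorff_content_mono)

lemma hausdorff_measure_Union_nat:
  "hausdorff_measure s (\<Union>n::nat. A n) \<le> (\<Sum>n. hausdorff_measure s (A n))"
proof (rule hausdorff_measure_leI)
  fix d :: real assume d: "0 < d"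
  have "hausdorff_content s d (\<Union>n. A n) \<le> (\<Sum>n. hausdorff_content s d (A n))"
    by (rule hausdorff_content_Union_nat)
  also have "\<dots> \<le> (\<Sum>n. hausdorff_measure s (A n))"
    by (intro suminf_le hausdorff_content_le_measure) (use d in auto)
  finally show "hausdorff_content s d (\<Union>n. A n) \<le> (\<Sum>n. hausdorff_measure s (A n))" .
qed

lemma hausdorff_measure_lipschitz_image:
  assumes "0 < s" "0 < L" "\<And>x y. x \<in> A \<Longrightarrow> y \<in> A \<Longrightarrow> dist (f x) (f y) \<le> L * dist x y"
  shows "hausdorff_measure s (f ` A) \<le> ennreal (L powr s) * hausdorff_measure s A"
proof (rule hausdorff_measure_leI)
  fix d :: real assume d: "0 < d"
  have "hausdorff_content s (ennreal d) (f ` A) \<le> ennreal (L powr s) * hausdorff_content s (ennreal (d / L)) A"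
    by (rule hausdorff_content_lipschitz_image) (use assms d in \<open>auto simp flip: ennreal_mult\<close>)
  also have "\<dots> \<le> ennreal (L powr s) * hausdorff_measure s A"
    by (intro mult_left_mono hausdorff_content_le_measure) (use assms d in auto)
  finally show "hausdorff_content s (ennreal d) (f ` A) \<le> ennreal (L powr s) * hausdorff_measure s A" .
qed

text \<open>The inverse of \<open>f\<close> on the image is Lipschitz with constant
  \<open>1/b\<close>, and the Lipschitz bound is applied to it. This is how the measure of a copy is
  bounded from below.\<close>

lemma hausdorff_measure_expanding_image:
  fixes f :: "'a::metric_space \<Rightarrow> 'b::metric_space"
  assumes s: "0 < s" and b: "0 < b"
    and f: "\<And>x y. x \<in> A \<Longrightarrow> y \<in> A \<Longrightarrow> b * dist x y \<le> dist (f x) (f y)"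
  shows "ennreal (b powr s) * hausdorff_measure s A \<le> hausdorff_measure s (f ` A)"
proof -
  have inj: "inj_on f A"
  proof (rule inj_onI)
    fix x y assume "x \<in> A" "y \<in> A" "f x = f y"
    with f[of x y] b have "dist x y \<le> 0" by (simp add: mult_le_0_iff)
    then show "x = y" by simp
  qed
  have "hausdorff_measure s (the_inv_into A f ` (f ` A)) \<le> ennreal ((1/b) powr s) * hausdorff_measure s (f ` A)"
  proof (rule hausdorff_measure_lipschitz_image[OF s])
    fix x y assume "x \<in> f ` A" "y \<in> f ` A"
    then obtain u v where "u \<in> A" "v \<in> A" "x = f u" "y = f v" by auto
    then show "dist (the_inv_into A f x) (the_inv_into A f y) \<le> 1 / b * dist x y"
      using f[of u v] b inj by (simp add: the_inv_into_f_f field_simps)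
  qed (use b in auto)
  also have "the_inv_into A f ` (f ` A) = A"
    using inj by (simp add: the_inv_into_onto)
  finally have "ennreal (b powr s) * hausdorff_measure s A
      \<le> ennreal (b powr s) * (ennreal ((1/b) powr s) * hausdorff_measure s (f ` A))"
    by (intro mult_left_mono) auto
  also have "\<dots> = (ennreal (b powr s) * ennreal ((1/b) powr s)) * hausdorff_measure s (f ` A)"
    by (simp add: mult.assoc)
  also have "ennreal (b powr s) * ennreal ((1/b) powr s) = 1"
    using b by (simp add: powr_divide flip: ennreal_mult)
  finally show ?thesis by simp
qed

text \<open>A covering set of diameter at most \<open>d < \<eta>\<close> cannot meet both sets, so
  every cover splits into two families that share no cost.\<close>

lemma hausdorff_content_separated:
  fixes A B :: "'a::metric_space set"
  assumes d: "0 \<le> d" "d < \<eta>" and AB: "\<And>x y. x \<in> A \<Longrightarrow> y \<in> B \<Longrightarrow> \<eta> \<le> dist x y"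
  shows "hausdorff_content s (ennreal d) A + hausdorff_content s (ennreal d) B
    \<le> hausdorff_content s (ennreal d) (A \<union> B)"
proof (rule hausdorff_content_ge)
  fix U :: "nat \<Rightarrow> 'a set"
  assume U: "A \<union> B \<subseteq> (\<Union>i. U i)" "\<And>i. ediameter (U i) \<le> ennreal d"
  define V where "V C i = (if U i \<inter> C = {} then {} else U i)" for C i
  have V: "hausdorff_content s (ennreal d) C \<le> (\<Sum>i. diam_pow s (V C i))" if "C \<subseteq> A \<union> B" for C
  proof (rule hausdorff_content_le)
    show "C \<subseteq> (\<Union>i. V C i)" using U(1) that unfolding V_def by fastforce
  qed (auto simp: V_def U(2))
  have disj: "U i \<inter> A = {} \<or> U i \<inter> B = {}" for i
  proof (rule ccontr)
    assume "\<not> ?thesis"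
    then obtain x y where xy: "x \<in> U i" "x \<in> A" "y \<in> U i" "y \<in> B" by auto
    have b: "bounded (U i)" "diameter (U i) \<le> d"
      using U(2)[of i] d by (auto simp: ediameter_def top_unique split: if_splits)
    then have "dist x y \<le> d" using xy diameter_bounded_bound[of "U i" x y] by simp
    then show False using AB[of x y] xy d by simp
  qed
  have "hausdorff_content s (ennreal d) A + hausdorff_content s (ennreal d) B
      \<le> (\<Sum>i. diam_pow s (V A i)) + (\<Sum>i. diam_pow s (V B i))"
    by (intro add_mono V) auto
  also have "\<dots> = (\<Sum>i. diam_pow s (V A i) + diam_pow s (V B i))"
    by (rule suminf_add) auto
  also have "\<dots> \<le> (\<Sum>i. diam_pow s (U i))"
    by (rule suminf_le) (use disj in \<open>auto simp: V_def\<close>)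
  finally show "hausdorff_content s (ennreal d) A + hausdorff_content s (ennreal d) B \<le> (\<Sum>i. diam_pow s (U i))" .
qed

lemma hausdorff_measure_separated:
  fixes A B :: "'a::metric_space set"
  assumes "0 < \<eta>" "\<And>x y. x \<in> A \<Longrightarrow> y \<in> B \<Longrightarrow> \<eta> \<le> dist x y"
  shows "hausdorff_measure s A + hausdorff_measure s B \<le> hausdorff_measure s (A \<union> B)"
proof -
  have lim: "((\<lambda>d. hausdorff_content s (ennreal d) C) \<longlongrightarrow> hausdorff_measure s C) (at_right (0::real))"
    for C :: "'a set"
    unfolding hausdorff_measure_eq_SUP by (rule hausdorff_content_tendsto_SUP)
  show ?thesis
  proof (rule tendsto_le[OF _ lim tendsto_add[OF lim lim]])
    show "\<forall>\<^sub>F d in at_right 0. hausdorff_content s (ennreal d) A + hausdorff_content s (ennreal d) B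
        \<le> hausdorff_content s (ennreal d) (A \<union> B)"
      using eventually_at_right_real[OF assms(1)]
      by eventually_elim (rule hausdorff_content_separated[of _ \<eta>], use assms(2) in auto)
  qed simp
qed

text \<open>For \<open>s > 0\<close> a cheap cover is automatically fine: if its total cost is below
  \<open>d powr s\<close>, every set in it has diameter below \<open>d\<close>.\<close>

lemma hausdorff_measure_eq_0:
  fixes A :: "'a::metric_space set"
  assumes s: "0 < s" and A: "hausdorff_content s \<infinity> A = 0"
  shows "hausdorff_measure s A = 0"
proof -
  have "hausdorff_measure s A \<le> 0"
  proof (rule hausdorff_measure_leI)
    fix d :: real assume d: "0 < d"
    show "hausdorff_content s (ennreal d) A \<le> 0"
    proof (rule ennreal_le_epsilon)
      fix e :: real assume e: "0 < e"
      have "hausdorff_content s \<infinity> A < ennreal (min e (d powr s))" using A d e by simp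
      then obtain U :: "nat \<Rightarrow> 'a set" where U: "A \<subseteq> (\<Union>i. U i)"
        "(\<Sum>i. diam_pow s (U i)) < ennreal (min e (d powr s))"
        by (elim hausdorff_content_coverE)
      have "ediameter (U i) \<le> ennreal d" for i
      proof -
        have "diam_pow s (U i) \<le> (\<Sum>i. diam_pow s (U i))"
          using sum_le_suminf[of "\<lambda>i. diam_pow s (U i)" "{i}"] by simp
        then have "diam_pow s (U i) < ennreal (min e (d powr s))" using U(2) by simp
        then have b: "bounded (U i)" and lt: "diameter (U i) powr s < d powr s"
          using s e d by (auto simp: diam_pow_pos ennreal_less_iff split: if_splits)
        have "diameter (U i) < d"
          using s lt d b by (meson diameter_ge_0 not_less powr_mono2 less_imp_le)
        then show ?thesis using b by (simp add: ediameter_def ennreal_leI)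
      qed
      then have "hausdorff_content s (ennreal d) A \<le> (\<Sum>i. diam_pow s (U i))"
        by (intro hausdorff_content_le U(1))
      also have "\<dots> \<le> ennreal e"
        using U(2) by (meson ennreal_leI less_imp_le min.cobounded1 order_less_le_trans)
      finally show "hausdorff_content s (ennreal d) A \<le> 0 + ennreal e" by simp
    qed
  qed
  then show ?thesis by simp
qed

lemma hausdorff_measure_antimono_exponent:
  fixes A :: "'a::metric_space set"
  assumes u: "0 \<le> u" "u \<le> t"
  shows "hausdorff_measure t A \<le> hausdorff_measure u A"
proof (rule hausdorff_measure_leI)
  fix d :: real assume d: "0 < d"
  \<comment> \<open>For diameters at most 1 powers decrease in the exponent.\<close>
  have "hausdorff_content t (ennreal d) A \<le> hausdorff_content t (ennreal (min d 1)) A"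
    by (rule hausdorff_content_antimono) (simp add: ennreal_leI)
  also have "\<dots> \<le> hausdorff_content u (ennreal (min d 1)) A"
  proof (rule hausdorff_content_ge)
    fix U :: "nat \<Rightarrow> 'a set"
    assume U: "A \<subseteq> (\<Union>i. U i)" "\<And>i. ediameter (U i) \<le> ennreal (min d 1)"
    have "hausdorff_content t (ennreal (min d 1)) A \<le> (\<Sum>i. diam_pow t (U i))"
      by (rule hausdorff_content_le) (use U in auto)
    also have "\<dots> \<le> (\<Sum>i. diam_pow u (U i))"
    proof (rule suminf_le)
      fix i
      have b: "bounded (U i)" "diameter (U i) \<le> 1"
        using U(2)[of i] d by (auto simp: ediameter_def top_unique split: if_splits)
      have g: "0 \<le> diameter (U i)" using b diameter_ge_0 by blast
      have "diameter (U i) powr t \<le> diameter (U i) powr u"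
        using g b u by (cases "diameter (U i) = 0") (auto intro: powr_mono')
      \<comment> \<open>Serves \<open>u = 0\<close>, where a nonempty set costs 1 even if its
        diameter is 0.\<close>
      moreover have "diameter (U i) powr t \<le> 1"
        using g b u by (intro powr_le1) auto
      ultimately show "diam_pow t (U i) \<le> diam_pow u (U i)"
        using b u by (auto simp: diam_pow_def ennreal_leI)
    qed auto
    finally show "hausdorff_content t (ennreal (min d 1)) A \<le> (\<Sum>i. diam_pow u (U i))" .
  qed
  also have "\<dots> \<le> hausdorff_measure u A"
    by (rule hausdorff_content_le_measure) (use d in auto)
  finally show "hausdorff_content t (ennreal d) A \<le> hausdorff_measure u A" .
qed


section \<open>Metric outer measures\<close>

text \<open>Caratheodory's argument. \<open>A - C\<close> is exhausted by the sets
  \<open>B n\<close> of points of \<open>A\<close> at distance at least \<open>1 / Suc n\<close>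
  from \<open>C\<close>, and each of these is separated from \<open>A \<inter> C\<close>. The
  differences \<open>R n\<close> are rings around \<open>C\<close>. Two rings with another one
  between them are separated, so the rings of either parity have total mass at most
  \<open>\<nu> A\<close>, and a tail of the rings is negligible.\<close>

lemma metric_outer_measure_closed:
  fixes \<nu> :: "'a::metric_space set \<Rightarrow> ennreal"
  assumes empty: "\<nu> {} = 0" and mono: "\<And>A B. A \<subseteq> B \<Longrightarrow> \<nu> A \<le> \<nu> B"
    and csub: "\<And>A :: nat \<Rightarrow> 'a set. \<nu> (\<Union>n. A n) \<le> (\<Sum>n. \<nu> (A n))"
    and sep: "\<And>A B \<eta>. 0 < \<eta> \<Longrightarrow> (\<And>x y. x \<in> A \<Longrightarrow> y \<in> B \<Longrightarrow> \<eta> \<le> dist x y) \<Longrightarrow> \<nu> A + \<nu> B \<le> \<nu> (A \<union> B)"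
    and C: "closed C"
  shows "\<nu> (A \<inter> C) + \<nu> (A - C) \<le> \<nu> A"
proof (cases "C = {} \<or> \<nu> A = \<infinity>")
  case True
  then show ?thesis using empty by auto
next
  case False
  then have ne: "C \<noteq> {}" and fin: "\<nu> A < \<infinity>" by (auto simp: top.not_eq_extremum)
  have sub: "\<nu> (S \<union> T) \<le> \<nu> S + \<nu> T" for S T
  proof -
    have "\<nu> (\<Union>n. binaryset S T n) \<le> (\<Sum>n. \<nu> (binaryset S T n))" by (rule csub)
    also have "\<dots> = \<nu> S + \<nu> T" by (rule suminf_binaryset_eq) (rule empty)
    finally show ?thesis by (simp add: UN_binaryset_eq)
  qed
  define B where "B n = {x \<in> A. 1 / real (Suc n) \<le> infdist x C}" for n
  define R where "R n = B (Suc n) - B n" for n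
  have Bsub: "B n \<subseteq> A" for n by (auto simp: B_def)
  have Bmono: "B m \<subseteq> B n" if "m \<le> n" for m n
  proof -
    have "1 / real (Suc n) \<le> 1 / real (Suc m)" using that by (intro divide_left_mono) auto
    then show ?thesis unfolding B_def by auto
  qed
  have gap: "1 / real (Suc n) - 1 / real (Suc (Suc n)) \<le> dist x y"
    if "x \<in> B n" "y \<in> R (Suc n)" for x y n
  proof -
    have "infdist y C < 1 / real (Suc (Suc n))" "1 / real (Suc n) \<le> infdist x C"
      using that Bsub unfolding R_def B_def by auto
    moreover have "infdist x C \<le> infdist y C + dist x y" by (rule infdist_triangle)
    ultimately show ?thesis by linarith
  qed
  \<comment> \<open>\<open>p\<close> is used with the values 0 and 1 to select the parity. By
    \<open>gap\<close> the next ring is separated from \<open>B (2 * n + p)\<close>, which contains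
    the rings already summed.\<close>
  have alternate_sums: "(\<Sum>k<n. \<nu> (R (Suc (2 * k + p)))) \<le> \<nu> (B (2 * n + p))" for n p
  proof (induction n)
    case (Suc n)
    have "(\<Sum>k<Suc n. \<nu> (R (Suc (2 * k + p)))) \<le> \<nu> (B (2 * n + p)) + \<nu> (R (Suc (2 * n + p)))"
      using Suc by (simp add: add_right_mono)
    also have "\<dots> \<le> \<nu> (B (2 * n + p) \<union> R (Suc (2 * n + p)))"
      by (rule sep[OF _ gap]) (simp_all add: frac_less2)
    also have "\<dots> \<le> \<nu> (B (2 * Suc n + p))"
      using Bmono[of "2 * n + p" "2 * Suc n + p"] by (intro mono) (auto simp: R_def)
    finally show ?case .
  qed simp
  define f where "f k = \<nu> (R (Suc k))" for k
  have sum_f: "(\<Sum>k<n. f k) \<le> \<nu> A + \<nu> A" for n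
  proof -
    have split: "(\<Sum>k<2*n. f k) = (\<Sum>k<n. f (2 * k)) + (\<Sum>k<n. f (2 * k + 1))" for n
      by (induction n) (auto simp: algebra_simps)
    have "(\<Sum>k<n. f k) \<le> (\<Sum>k<2*n. f k)" by (rule sum_mono2) auto
    also have "\<dots> \<le> \<nu> (B (2 * n + 0)) + \<nu> (B (2 * n + 1))"
      unfolding split unfolding f_def using alternate_sums[of 0 n] alternate_sums[of 1 n] by (intro add_mono) auto
    also have "\<dots> \<le> \<nu> A + \<nu> A" by (intro add_mono mono Bsub)
    finally show ?thesis .
  qed
  have suminf_f: "(\<Sum>k. f k) \<noteq> top"
    using suminf_le_const[OF summableI sum_f] fin by (auto simp: top_unique)
  have f_fin: "f k < top" for k
    using suminf_f by (meson ennreal_suminf_lessD top.not_eq_extremum)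
  then have f_real: "f = (\<lambda>k. ennreal (enn2real (f k)))" by auto
  have sm: "summable (\<lambda>k. enn2real (f k))"
    by (rule summable_suminf_not_top) (use f_real suminf_f in auto)
  show ?thesis
  proof (rule ennreal_le_epsilon)
    fix e :: real assume e: "0 < e"
    from suminf_exist_split[OF e sm] obtain n where n: "norm (\<Sum>k. enn2real (f (k + n))) < e" by blast
    have "(\<Sum>k. f (k + n)) = (\<Sum>k. ennreal (enn2real (f (k + n))))" using f_real by metis
    also have "\<dots> = ennreal (\<Sum>k. enn2real (f (k + n)))"
      by (rule suminf_ennreal2) (use sm summable_iff_shift[of "\<lambda>k. enn2real (f k)" n] in auto)
    also have "\<dots> \<le> ennreal e" using n by (intro ennreal_leI) auto
    finally have tail: "(\<Sum>k. f (k + n)) \<le> ennreal e" .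
    have "A - C \<subseteq> B (Suc n) \<union> (\<Union>k. R (Suc (k + n)))"
    proof
      fix x assume x: "x \<in> A - C"
      then have "0 < infdist x C" using C ne by (simp add: infdist_pos_not_in_closed)
      then obtain m where "1 / real (Suc m) < infdist x C" by (metis nat_approx_posE inverse_eq_divide)
      then have xm: "x \<in> B m" using x by (auto simp: B_def)
      \<comment> \<open>The first index whose set contains \<open>x\<close> identifies its ring;
        indices up to \<open>Suc n\<close> are absorbed by \<open>B (Suc n)\<close>.\<close>
      define l where "l = (LEAST m. x \<in> B m)"
      have xl: "x \<in> B l" unfolding l_def using xm by (rule LeastI)
      show "x \<in> B (Suc n) \<union> (\<Union>k. R (Suc (k + n)))"
      proof (cases "l \<le> Suc n")
        case True then show ?thesis using Bmono xl by blast
      next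
        case False
        then have "l = Suc (Suc ((l - 2 - n) + n))" by simp
        moreover have "x \<notin> B (l - 1)" using not_less_Least[of "l - 1" "\<lambda>m. x \<in> B m"] False
          unfolding l_def by simp
        ultimately have "x \<in> R (Suc ((l - 2 - n) + n))" using xl unfolding R_def
          by (metis DiffI diff_Suc_1)
        then show ?thesis by blast
      qed
    qed
    then have "\<nu> (A - C) \<le> \<nu> (B (Suc n)) + \<nu> (\<Union>k. R (Suc (k + n)))"
      using mono sub order_trans by blast
    also have "\<nu> (\<Union>k. R (Suc (k + n))) \<le> (\<Sum>k. f (k + n))" unfolding f_def by (rule csub)
    also note tail
    finally have "\<nu> (A \<inter> C) + \<nu> (A - C) \<le> \<nu> (A \<inter> C) + (\<nu> (B (Suc n)) + ennreal e)"
      by (simp add: add_left_mono)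
    also have "\<dots> = (\<nu> (A \<inter> C) + \<nu> (B (Suc n))) + ennreal e" by (simp add: add.assoc)
    also have "\<nu> (A \<inter> C) + \<nu> (B (Suc n)) \<le> \<nu> (A \<inter> C \<union> B (Suc n))"
    proof (rule sep)
      show "0 < 1 / real (Suc (Suc n))" by simp
      fix x y assume "x \<in> A \<inter> C" "y \<in> B (Suc n)"
      then show "1 / real (Suc (Suc n)) \<le> dist x y"
        using infdist_le[of x C y] by (auto simp: B_def dist_commute)
    qed
    also have "\<nu> (A \<inter> C \<union> B (Suc n)) \<le> \<nu> A" by (intro mono) (use Bsub in auto)
    finally show "\<nu> (A \<inter> C) + \<nu> (A - C) \<le> \<nu> A + ennreal e" by (simp add: add_right_mono)
  qed
qed

text \<open>Closed sets satisfy Caratheodory's criterion and generate the Borel sets. The measure is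
  restricted from the full system \<open>L\<close> to the Borel sets because
  \<open>radon_measure\<close> fixes these as the measurable sets.\<close>

lemma metric_outer_measure_borel:
  fixes \<nu> :: "'a::metric_space set \<Rightarrow> ennreal"
  assumes empty: "\<nu> {} = 0" and mono: "\<And>A B. A \<subseteq> B \<Longrightarrow> \<nu> A \<le> \<nu> B"
    and csub: "\<And>A :: nat \<Rightarrow> 'a set. \<nu> (\<Union>n. A n) \<le> (\<Sum>n. \<nu> (A n))"
    and sep: "\<And>A B \<eta>. 0 < \<eta> \<Longrightarrow> (\<And>x y. x \<in> A \<Longrightarrow> y \<in> B \<Longrightarrow> \<eta> \<le> dist x y) \<Longrightarrow> \<nu> A + \<nu> B \<le> \<nu> (A \<union> B)"
  obtains M where "sets M = sets borel" "\<And>A. A \<in> sets borel \<Longrightarrow> emeasure M A = \<nu> A"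
proof -
  interpret P: sigma_algebra UNIV "UNIV :: 'a set set"
    using sigma_algebra_Pow[of "UNIV :: 'a set"] by simp
  define L where "L = lambda_system (UNIV :: 'a set) UNIV \<nu>"
  have "outer_measure_space UNIV \<nu>"
    unfolding outer_measure_space_def positive_def increasing_def countably_subadditive_def
    using empty mono csub by auto
  then have ms: "measure_space UNIV L \<nu>"
    unfolding L_def by (rule P.caratheodory_lemma)
  then interpret L: sigma_algebra UNIV L by (simp add: measure_space_def)
  have sub: "\<nu> S \<le> \<nu> (S \<inter> T) + \<nu> (S - T)" for S T
  proof -
    have "\<nu> (\<Union>n. binaryset (S \<inter> T) (S - T) n) \<le> (\<Sum>n. \<nu> (binaryset (S \<inter> T) (S - T) n))" by (rule csub)
    also have "\<dots> = \<nu> (S \<inter> T) + \<nu> (S - T)" by (rule suminf_binaryset_eq) (rule empty)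
    finally show ?thesis by (simp add: UN_binaryset_eq Int_Diff_Un)
  qed
  have "{S. closed S} \<subseteq> L"
    unfolding L_def P.lambda_system_eq
    using metric_outer_measure_closed[of \<nu>, OF empty mono csub sep] sub by (auto intro!: antisym)
  then have "sigma_sets UNIV {S. closed S} \<subseteq> L" by (rule L.sigma_sets_subset)
  then have borel: "sets borel \<subseteq> L" by (simp add: borel_eq_closed)
  have ca: "positive (sets borel) \<nu>" "countably_additive (sets borel) \<nu>"
    using ms borel unfolding measure_space_def positive_def countably_additive_def by auto
  define M where "M = measure_of (UNIV :: 'a set) (sets borel) \<nu>"
  have sM: "sets M = sets borel"
    unfolding M_def using sets.sets_measure_of_eq[of borel] by simp
  moreover have "emeasure M A = \<nu> A" if "A \<in> sets borel" for A
    by (rule emeasure_measure_of[OF M_def]) (use ca sM that in auto)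
  ultimately show ?thesis using that by blast
qed

section \<open>Quasi self-similar sets\<close>

text \<open>No exponent below \<open>t\<close> belongs to the set defining the dimension, by
  monotonicity in the exponent; \<open>u\<close> shows that this set is nonempty, so that its
  infimum is meaningful.\<close>

lemma hausdorff_dim_ge:
  assumes "0 < hausdorff_measure t F" "0 \<le> u" "hausdorff_measure u F = 0"
  shows "t \<le> hausdorff_dim F"
  unfolding hausdorff_dim_def
proof (rule cInf_greatest)
  fix v assume "v \<in> {s. 0 \<le> s \<and> hausdorff_measure s F = 0}"
  then show "t \<le> v"
    using hausdorff_measure_antimono_exponent[of v t F] assms(1) by (cases "t \<le> v") auto
qed (use assms in auto)

text \<open>Countable covers are reduced to finite ones: each set is enlarged to an open
  neighbourhood at an extra cost below \<open>e * (1/2)^Suc i\<close>, and compactness selects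
  finitely many of these.\<close>

lemma compact_hausdorff_content_ge:
  fixes F :: "'a::metric_space set"
  assumes F: "compact F" and t: "0 < t"
    and c: "\<And>(I :: nat set) U. finite I \<Longrightarrow> F \<subseteq> (\<Union>i\<in>I. U i) \<Longrightarrow> (\<And>i. i \<in> I \<Longrightarrow> bounded (U i)) \<Longrightarrow>
      c \<le> (\<Sum>i\<in>I. diameter (U i) powr t)"
  shows "ennreal c \<le> hausdorff_content t \<infinity> F"
proof (rule hausdorff_content_ge)
  fix U :: "nat \<Rightarrow> 'a set"
  assume cov: "F \<subseteq> (\<Union>i. U i)"
  show "ennreal c \<le> (\<Sum>i. diam_pow t (U i))"
  proof (rule ennreal_le_epsilon)
    fix e :: real assume e: "0 < e" and fin: "(\<Sum>i. diam_pow t (U i)) < top"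
    have bU: "bounded (U i)" for i
    proof (rule ccontr)
      assume "\<not> bounded (U i)"
      then have "diam_pow t (U i) = top" using t by (simp add: diam_pow_pos)
      then show False using fin by (metis ennreal_suminf_lessD order_less_irrefl)
    qed
    have "\<exists>d>0. (diameter (U i) + 2 * d) powr t < diameter (U i) powr t + e * (1/2)^Suc i" for i
    proof -
      \<comment> \<open>The diameter may be 0; continuity of the power there rests on
        \<open>t > 0\<close> and on a one-sided limit.\<close>
      have "((\<lambda>d. (diameter (U i) + 2 * d) powr t) \<longlongrightarrow> (diameter (U i) + 2 * 0) powr t) (at_right 0)"
        using t diameter_ge_0[OF bU]
        by (intro tendsto_powr') (auto intro!: tendsto_eq_intros eventually_at_rightI[of 0 1])
      then have "\<forall>\<^sub>F d in at_right 0. (diameter (U i) + 2 * d) powr t < diameter (U i) powr t + e * (1/2)^Suc i"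
        by (rule order_tendstoD) (use e in simp)
      then have "\<forall>\<^sub>F d in at_right 0. 0 < d \<and> (diameter (U i) + 2 * d) powr t < diameter (U i) powr t + e * (1/2)^Suc i"
        using eventually_at_right_less by (rule eventually_elim2) auto
      then show ?thesis using eventually_happens by fastforce
    qed
    then obtain d where d: "\<And>i. 0 < d i"
      "\<And>i. (diameter (U i) + 2 * d i) powr t < diameter (U i) powr t + e * (1/2)^Suc i"
      by metis
    define V where "V i = (\<Union>x\<in>U i. ball x (d i))" for i
    have VV: "dist x y \<le> diameter (U i) + 2 * d i" if "x \<in> V i" "y \<in> V i" for x y i
    proof -
      have "\<exists>u\<in>U i. dist u x < d i" "\<exists>v\<in>U i. dist v y < d i"
        using that by (auto simp: V_def)
      then obtain u v where "u \<in> U i" "dist u x < d i" "v \<in> U i" "dist v y < d i" by blast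
      moreover have "dist u v \<le> diameter (U i)"
        using calculation bU by (intro diameter_bounded_bound) auto
      moreover have "dist x y \<le> dist u x + dist u v + dist v y" by metric
      ultimately show ?thesis by linarith
    qed
    have bV: "bounded (V i)" for i unfolding bounded_two_points using VV by blast
    have dV: "diameter (V i) \<le> diameter (U i) + 2 * d i" for i
      by (rule diameter_leI) (use VV d(1)[of i] diameter_ge_0[OF bU, of i] in \<open>auto simp: less_imp_le\<close>)
    have "F \<subseteq> (\<Union>i. V i)"
    proof
      fix x assume "x \<in> F"
      then obtain i where "x \<in> U i" using cov by blast
      then have "x \<in> V i" unfolding V_def using d(1)[of i] by (intro UN_I[of x]) auto
      then show "x \<in> (\<Union>i. V i)" by blast
    qed
    moreover have "open (V i)" for i unfolding V_def by blast
    ultimately obtain I where I: "finite I" "F \<subseteq> (\<Union>i\<in>I. V i)"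
      using compactE_image[OF F, of UNIV V] by metis
    have "c \<le> (\<Sum>i\<in>I. diameter (V i) powr t)" by (rule c[OF I]) (rule bV)
    also have "\<dots> \<le> (\<Sum>i\<in>I. diameter (U i) powr t + e * (1/2)^Suc i)"
    proof (rule sum_mono)
      fix i
      have "diameter (V i) powr t \<le> (diameter (U i) + 2 * d i) powr t"
        using t dV diameter_ge_0[OF bV] by (intro powr_mono2) auto
      then show "diameter (V i) powr t \<le> diameter (U i) powr t + e * (1/2)^Suc i"
        using d(2)[of i] by linarith
    qed
    also have "\<dots> = (\<Sum>i\<in>I. diameter (U i) powr t) + e * (\<Sum>i\<in>I. (1/2)^Suc i)"
      by (simp add: sum.distrib sum_distrib_left)
    also have "(\<Sum>i\<in>I. (1/2::real)^Suc i) \<le> 1"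
      using sum_le_suminf[OF sums_summable[OF power_half_series] I(1)] sums_unique[OF power_half_series]
      by auto
    finally have "c \<le> (\<Sum>i\<in>I. diameter (U i) powr t) + e" using e by (simp add: mult_left_mono)
    then have "ennreal c \<le> ennreal ((\<Sum>i\<in>I. diameter (U i) powr t) + e)" by (rule ennreal_leI)
    also have "\<dots> = (\<Sum>i\<in>I. diam_pow t (U i)) + ennreal e"
      using e t bU by (simp add: diam_pow_pos sum_nonneg ennreal_plus)
    also have "(\<Sum>i\<in>I. diam_pow t (U i)) \<le> (\<Sum>i. diam_pow t (U i))"
      by (rule sum_le_suminf) (use I in auto)
    finally show "ennreal c \<le> (\<Sum>i. diam_pow t (U i)) + ennreal e" by (simp add: add_right_mono)
  qed
qed

text \<open>The Cantor set itself is never formed; the bound follows by induction on the covering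
  family. Either one set meets two copies, and then its diameter is at least \<open>\<eta>\<close>;
  or the sets meeting different copies form disjoint subfamilies, which pull back along
  \<open>g j\<close> to smaller covers of \<open>F\<close>. The pullback loses a factor
  \<open>b powr t\<close>, and the number of copies makes up for it.\<close>

lemma separated_copies_finite_cover:
  fixes F :: "'a::metric_space set"
  assumes F: "F \<noteq> {}" "bounded F" and J: "finite J" and b: "0 < b" "b < 1" and \<eta>: "0 < \<eta>" and t: "0 < t"
    and gF: "\<And>j. j \<in> J \<Longrightarrow> g j ` F \<subseteq> F"
    and g: "\<And>j u v. j \<in> J \<Longrightarrow> u \<in> F \<Longrightarrow> v \<in> F \<Longrightarrow> b * dist u v \<le> dist (g j u) (g j v)"
    and sep: "\<And>i j u v. i \<in> J \<Longrightarrow> j \<in> J \<Longrightarrow> i \<noteq> j \<Longrightarrow> u \<in> F \<Longrightarrow> v \<in> F \<Longrightarrow> \<eta> \<le> dist (g i u) (g j v)"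
    and card: "1 \<le> real (card J) * b powr t"
  shows "finite I \<Longrightarrow> F \<subseteq> (\<Union>i\<in>I. U i) \<Longrightarrow> (\<And>i. i \<in> I \<Longrightarrow> bounded (U i)) \<Longrightarrow>
    \<eta> powr t \<le> (\<Sum>i\<in>I. diameter (U i) powr t)"
proof (induction I arbitrary: U rule: finite_psubset_induct)
  case (psubset I U)
  show ?case
  proof (cases "\<exists>i\<in>I. \<exists>j\<in>J. \<exists>j'\<in>J. j \<noteq> j' \<and> U i \<inter> g j ` F \<noteq> {} \<and> U i \<inter> g j' ` F \<noteq> {}")
    case True
    then obtain i j j' u v where *: "i \<in> I" "j \<in> J" "j' \<in> J" "j \<noteq> j'" "u \<in> F" "v \<in> F" "g j u \<in> U i" "g j' v \<in> U i"
      by blast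
    have "\<eta> \<le> dist (g j u) (g j' v)" using * by (intro sep)
    also have "\<dots> \<le> diameter (U i)"
      by (rule diameter_bounded_bound) (use * psubset.prems in auto)
    finally have "\<eta> powr t \<le> diameter (U i) powr t" using \<eta> t by (intro powr_mono2) auto
    also have "\<dots> \<le> (\<Sum>i\<in>I. diameter (U i) powr t)"
      by (rule member_le_sum) (use * psubset in auto)
    finally show ?thesis .
  next
    case False
    define G where "G j = {i \<in> I. U i \<inter> g j ` F \<noteq> {}}" for j
    have disj: "G j \<inter> G j' = {}" if "j \<in> J" "j' \<in> J" "j \<noteq> j'" for j j'
      using False that unfolding G_def by blast
    have Gne: "G j \<noteq> {}" if j: "j \<in> J" for j
    proof -
      obtain u where u: "u \<in> F" using F by blast
      then have "g j u \<in> F" using gF j by blast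
      then obtain i where "i \<in> I" "g j u \<in> U i" using psubset.prems(1) by blast
      then show ?thesis unfolding G_def using u by blast
    qed
    \<comment> \<open>With a second copy present, each subfamily omits the sets that meet the other
      one. It is then a proper subfamily, and the induction hypothesis applies.\<close>
    have card2: "card J > 1"
    proof (rule ccontr)
      assume "\<not> ?thesis"
      then have "real (card J) * b powr t \<le> 1 * b powr t" by (intro mult_right_mono) auto
      also have "b powr t < 1" using b t powr_less_mono2[of t b 1] by simp
      finally show False using card by simp
    qed
    have part: "b powr t * \<eta> powr t \<le> (\<Sum>i\<in>G j. diameter (U i) powr t)" if j: "j \<in> J" for j
    proof -
      obtain j' where j': "j' \<in> J" "j' \<noteq> j"
      proof -
        have "J \<noteq> {j}" using card2 by auto
        then show ?thesis using j that by blast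
      qed
      have ps: "G j \<subset> I"
      proof -
        obtain i where "i \<in> G j'" using Gne[OF j'(1)] by blast
        then have "i \<in> I" "i \<notin> G j" using disj[OF j j'(1)] j'(2) by (auto simp: G_def)
        then show ?thesis by (auto simp: G_def)
      qed
      define V where "V i = {u \<in> F. g j u \<in> U i}" for i
      have bV: "bounded (V i)" for i using F(2) by (rule bounded_subset) (auto simp: V_def)
      have dV: "diameter (V i) \<le> diameter (U i) / b" if "i \<in> I" for i
      proof (rule diameter_leI)
        have bi: "bounded (U i)" using psubset.prems that by blast
        show "0 \<le> diameter (U i) / b" using diameter_ge_0[OF bi] b by simp
        fix x y assume "x \<in> V i" "y \<in> V i"
        then have "b * dist x y \<le> diameter (U i)"
          using g[OF j, of x y] diameter_bounded_bound[OF bi, of "g j x" "g j y"] by (auto simp: V_def)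
        then show "dist x y \<le> diameter (U i) / b" using b by (simp add: field_simps)
      qed
      have "\<eta> powr t \<le> (\<Sum>i\<in>G j. diameter (V i) powr t)"
      proof (rule psubset.IH[OF ps])
        show "F \<subseteq> (\<Union>i\<in>G j. V i)"
        proof
          fix u assume u: "u \<in> F"
          then have "g j u \<in> F" using gF j by blast
          then obtain i where "i \<in> I" "g j u \<in> U i" using psubset.prems(1) by blast
          then show "u \<in> (\<Union>i\<in>G j. V i)" using u unfolding G_def V_def by blast
        qed
      qed (rule bV)
      also have "\<dots> \<le> (\<Sum>i\<in>G j. (diameter (U i) / b) powr t)"
        using t dV diameter_ge_0[OF bV] by (intro sum_mono powr_mono2) (auto simp: G_def)
      also have "\<dots> = (\<Sum>i\<in>G j. diameter (U i) powr t) / b powr t"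
        unfolding sum_divide_distrib
        by (simp add: powr_divide)
      finally show ?thesis using b by (simp add: field_simps)
    qed
    have "\<eta> powr t \<le> (real (card J) * b powr t) * \<eta> powr t"
      using card mult_right_mono[of 1 "real (card J) * b powr t" "\<eta> powr t"] by simp
    also have "\<dots> = (\<Sum>j\<in>J. b powr t * \<eta> powr t)" by simp
    also have "\<dots> \<le> (\<Sum>j\<in>J. \<Sum>i\<in>G j. diameter (U i) powr t)" by (intro sum_mono part)
    also have "\<dots> = (\<Sum>i\<in>(\<Union>j\<in>J. G j). diameter (U i) powr t)"
    proof (rule sum.UNION_disjoint[symmetric])
      show "\<forall>j\<in>J. finite (G j)" using psubset.hyps by (simp add: G_def)
      show "\<forall>i\<in>J. \<forall>j\<in>J. i \<noteq> j \<longrightarrow> G i \<inter> G j = {}" using disj by blast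
    qed (rule J)
    also have "\<dots> \<le> (\<Sum>i\<in>I. diameter (U i) powr t)"
    proof (rule sum_mono2)
      show "(\<Union>j\<in>J. G j) \<subseteq> I" unfolding G_def by blast
    qed (simp_all add: psubset.hyps)
    finally show ?thesis .
  qed
qed

text \<open>A separated subset of largest cardinality is taken. It exists because every such set
  injects into the centres of a finite cover by balls of radius \<open>r/2\<close>; a point of
  \<open>F\<close> outside all \<open>cball t r\<close> could be added to it.\<close>

lemma compact_packing:
  fixes F :: "'a::metric_space set"
  assumes "compact F" "0 < r"
  obtains T where "finite T" "T \<subseteq> F" "\<forall>x\<in>T. \<forall>y\<in>T. x \<noteq> y \<longrightarrow> r < dist x y"
    "F \<subseteq> (\<Union>t\<in>T. cball t r)"
proof -
  define P where "P T \<longleftrightarrow> finite T \<and> T \<subseteq> F \<and> (\<forall>x\<in>T. \<forall>y\<in>T. x \<noteq> y \<longrightarrow> r < dist x y)" for T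
  have "F \<subseteq> (\<Union>x\<in>F. ball x (r/2))" using assms(2) by auto
  then obtain k where k: "finite k" "F \<subseteq> (\<Union>x\<in>k. ball x (r/2))"
    using compactE_image[OF assms(1), of F "\<lambda>x. ball x (r/2)"] open_ball by metis
  have bound: "card T < Suc (card k)" if T: "P T" for T
  proof -
    have "\<forall>x\<in>T. \<exists>y\<in>k. dist y x < r/2" using T k(2) unfolding P_def by fastforce
    then obtain h where h: "\<And>x. x \<in> T \<Longrightarrow> h x \<in> k \<and> dist (h x) x < r/2" by metis
    have "inj_on h T"
    proof (rule inj_onI, rule ccontr)
      fix x y assume xy: "x \<in> T" "y \<in> T" "h x = h y" "x \<noteq> y"
      have "dist x y \<le> dist (h x) x + dist (h x) y" by metric
      then have "dist x y < r" using h[OF xy(1)] h[OF xy(2)] xy(3) by simp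
      then show False using T xy unfolding P_def by fastforce
    qed
    then have "card T \<le> card k" using h k(1) by (intro card_inj_on_le[of h]) auto
    then show ?thesis by simp
  qed
  have "P {}" by (simp add: P_def)
  then obtain T where T: "P T" "\<And>S. P S \<Longrightarrow> card S \<le> card T"
    using ex_has_greatest_nat[of P "{}" card "Suc (card k)"] bound by blast
  have "F \<subseteq> (\<Union>t\<in>T. cball t r)"
  proof (rule ccontr)
    assume "\<not> ?thesis"
    then obtain x where x: "x \<in> F" and "x \<notin> (\<Union>t\<in>T. cball t r)" by blast
    then have far: "\<And>t. t \<in> T \<Longrightarrow> r < dist t x" by fastforce
    with x have "P (insert x T)" using T(1) unfolding P_def by (auto simp: dist_commute)
    moreover have "x \<notin> T" using far assms(2) by fastforce
    ultimately show False using T(2)[of "insert x T"] T(1) by (auto simp: P_def)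
  qed
  then show ?thesis using that[of T] T(1) unfolding P_def by blast
qed

text \<open>All that the measure-theoretic part uses of the system. Two distinct points make the
  diameter and the dimension positive; \<open>u\<close> ensures that the infimum defining the
  dimension is over a nonempty set.\<close>

locale quasi_self_similar =
  fixes F :: "'a::euclidean_space set" and a K u :: real
  assumes compact_F: "compact F"
    and nontrivial: "\<exists>x\<in>F. \<exists>y\<in>F. x \<noteq> y"
    and a: "0 < a" "a < 1" and K: "1 \<le> K"
    and local_copy: "\<And>x r. x \<in> F \<Longrightarrow> 0 < r \<Longrightarrow> r \<le> 1 \<Longrightarrow>
      \<exists>g. g ` F \<subseteq> F \<and> x \<in> g ` F \<and>
        (\<forall>v\<in>F. \<forall>w\<in>F. a * r * dist v w \<le> dist (g v) (g w) \<and> dist (g v) (g w) \<le> K * r * dist v w)"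
    and u: "0 \<le> u" "hausdorff_measure u F = 0"
begin

abbreviation "s \<equiv> hausdorff_dim F"
abbreviation "D \<equiv> diameter F"

lemma F_ne: "F \<noteq> {}" using nontrivial by blast

lemma bounded_F: "bounded F" using compact_F by (rule compact_imp_bounded)

lemma dist_le_D: "x \<in> F \<Longrightarrow> y \<in> F \<Longrightarrow> dist x y \<le> D"
  using bounded_F by (rule diameter_bounded_bound)

lemma D_pos: "0 < D"
proof -
  obtain x y where "x \<in> F" "y \<in> F" "x \<noteq> y" using nontrivial by blast
  then show ?thesis using dist_le_D[of x y] by (smt (verit) zero_less_dist_iff)
qed

text \<open>\<open>3 * (K * r * D)\<close> is the packing radius: a copy has diameter at most
  \<open>K * r * D\<close>, so centres farther apart than three times this leave a gap of
  \<open>K * r * D\<close> between copies. The covering by balls of the same radius is the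
  maximality of the packing.\<close>

definition separated_copies :: "real \<Rightarrow> 'a set \<Rightarrow> ('a \<Rightarrow> 'a \<Rightarrow> 'a) \<Rightarrow> bool" where
  "separated_copies r T g \<longleftrightarrow>
     finite T \<and> T \<subseteq> F \<and> F \<subseteq> (\<Union>t\<in>T. cball t (3 * (K * r * D))) \<and>
     (\<forall>t\<in>T. g t ` F \<subseteq> F) \<and>
     (\<forall>t\<in>T. \<forall>v\<in>F. \<forall>w\<in>F. a * r * dist v w \<le> dist (g t v) (g t w) \<and> dist (g t v) (g t w) \<le> K * r * dist v w) \<and>
     (\<forall>t\<in>T. \<forall>t'\<in>T. t \<noteq> t' \<longrightarrow> (\<forall>v\<in>F. \<forall>w\<in>F. K * r * D \<le> dist (g t v) (g t' w)))"

lemma separated_copiesD: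
  assumes "separated_copies r T g"
  shows "finite T" "T \<subseteq> F" "F \<subseteq> (\<Union>t\<in>T. cball t (3 * (K * r * D)))"
    "\<And>t. t \<in> T \<Longrightarrow> g t ` F \<subseteq> F"
    "\<And>t v w. t \<in> T \<Longrightarrow> v \<in> F \<Longrightarrow> w \<in> F \<Longrightarrow> a * r * dist v w \<le> dist (g t v) (g t w)"
    "\<And>t v w. t \<in> T \<Longrightarrow> v \<in> F \<Longrightarrow> w \<in> F \<Longrightarrow> dist (g t v) (g t w) \<le> K * r * dist v w"
    "\<And>t t' v w. t \<in> T \<Longrightarrow> t' \<in> T \<Longrightarrow> t \<noteq> t' \<Longrightarrow> v \<in> F \<Longrightarrow> w \<in> F \<Longrightarrow> K * r * D \<le> dist (g t v) (g t' w)"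
  using assms unfolding separated_copies_def by simp_all

lemma packing_copies:
  assumes r: "0 < r" "r \<le> 1"
  obtains T g where "separated_copies r T g"
proof -
  have pos: "0 < K * r * D" using r K D_pos by simp
  then have "0 < 3 * (K * r * D)" by simp
  then obtain T where T: "finite T" "T \<subseteq> F" "\<forall>x\<in>T. \<forall>y\<in>T. x \<noteq> y \<longrightarrow> 3 * (K * r * D) < dist x y"
    "F \<subseteq> (\<Union>t\<in>T. cball t (3 * (K * r * D)))"
    by (rule compact_packing[OF compact_F])
  have "\<forall>t\<in>T. \<exists>g. g ` F \<subseteq> F \<and> t \<in> g ` F \<and>
        (\<forall>v\<in>F. \<forall>w\<in>F. a * r * dist v w \<le> dist (g v) (g w) \<and> dist (g v) (g w) \<le> K * r * dist v w)"
    using local_copy r T(2) by blast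
  then obtain g where g: "\<And>t. t \<in> T \<Longrightarrow> g t ` F \<subseteq> F \<and> t \<in> g t ` F \<and>
        (\<forall>v\<in>F. \<forall>w\<in>F. a * r * dist v w \<le> dist (g t v) (g t w) \<and> dist (g t v) (g t w) \<le> K * r * dist v w)"
    by metis
  have near: "dist t (g t v) \<le> K * r * D" if tv: "t \<in> T" "v \<in> F" for t v
  proof -
    obtain p where p: "p \<in> F" "t = g t p" using g[OF tv(1)] by blast
    then have "dist t (g t v) \<le> K * r * dist p v" using g[OF tv(1)] tv(2) by metis
    also have "\<dots> \<le> K * r * D" using dist_le_D[OF p(1) tv(2)] r K by (intro mult_left_mono) auto
    finally show ?thesis .
  qed
  have "K * r * D \<le> dist (g t v) (g t' w)" if "t \<in> T" "t' \<in> T" "t \<noteq> t'" "v \<in> F" "w \<in> F" for t t' v w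
  proof -
    have "dist t t' \<le> dist t (g t v) + dist (g t v) (g t' w) + dist t' (g t' w)" by metric
    then show ?thesis using near[of t v] near[of t' w] T(3)[rule_format, of t t'] that by simp
  qed
  then have "separated_copies r T g" using T g unfolding separated_copies_def by blast
  then show ?thesis by (rule that)
qed

text \<open>\<open>6 * K * D * r\<close> is the diameter of one packing ball, and one ball for each
  centre covers \<open>F\<close>.\<close>

lemma content_le_card:
  assumes "finite T" "F \<subseteq> (\<Union>t\<in>T. cball t (3 * (K * r * D)))" "0 < r" "0 < q"
  shows "hausdorff_content q (ennreal (6 * K * D * r)) F \<le> ennreal (card T * (6 * K * D * r) powr q)"
proof -
  have pos: "0 < K * r * D" using assms K D_pos by simp
  have "hausdorff_content q (ennreal (6 * K * D * r)) F
      \<le> hausdorff_content q (ennreal (6 * K * D * r)) (\<Union>t\<in>T. cball t (3 * (K * r * D)))"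
    by (rule hausdorff_content_mono) (rule assms)
  also have "\<dots> \<le> (\<Sum>t\<in>T. hausdorff_content q (ennreal (6 * K * D * r)) (cball t (3 * (K * r * D))))"
    by (rule hausdorff_content_UN_finite) (rule assms)
  also have "\<dots> \<le> (\<Sum>t\<in>T. ennreal ((6 * K * D * r) powr q))"
  proof (rule sum_mono)
    fix t :: 'a
    have *: "diameter (cball t (3 * (K * r * D))) = 6 * K * D * r"
      using pos unfolding diameter_cball by (simp add: mult_ac)
    have "hausdorff_content q (ennreal (6 * K * D * r)) (cball t (3 * (K * r * D))) \<le> diam_pow q (cball t (3 * (K * r * D)))"
      by (rule hausdorff_content_le_diam_pow) (unfold ediameter_def *, simp)
    also have "\<dots> = ennreal ((6 * K * D * r) powr q)" unfolding diam_pow_pos[OF assms(4)] * by simp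
    finally show "hausdorff_content q (ennreal (6 * K * D * r)) (cball t (3 * (K * r * D))) \<le> ennreal ((6 * K * D * r) powr q)" .
  qed
  also have "\<dots> = ennreal (card T * (6 * K * D * r) powr q)"
    by (simp add: ennreal_mult ennreal_of_nat_eq_real_of_nat)
  finally show ?thesis .
qed

text \<open>A product of at least 2 leaves room to raise the exponent above \<open>q\<close> and
  still have the product 1 that \<open>separated_copies_finite_cover\<close> asks for.\<close>

lemma dim_gt:
  assumes r: "0 < r" "r \<le> 1" and q: "0 \<le> q"
    and T: "finite T" "\<And>t. t \<in> T \<Longrightarrow> g t ` F \<subseteq> F"
    "\<And>t v w. t \<in> T \<Longrightarrow> v \<in> F \<Longrightarrow> w \<in> F \<Longrightarrow> a * r * dist v w \<le> dist (g t v) (g t w)"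
    "\<And>t t' v w. t \<in> T \<Longrightarrow> t' \<in> T \<Longrightarrow> t \<noteq> t' \<Longrightarrow> v \<in> F \<Longrightarrow> w \<in> F \<Longrightarrow> K * r * D \<le> dist (g t v) (g t' w)"
    and card: "2 \<le> real (card T) * (a * r) powr q"
  shows "q < s"
proof -
  define b where "b = a * r"
  have b: "0 < b" "b < 1" using a r mult_le_one[of a r] unfolding b_def
    by (auto, smt (verit) mult_left_le)
  \<comment> \<open>Chosen so that \<open>b powr t\<close> is half of \<open>b powr q\<close>; it
    exceeds \<open>q\<close> because \<open>ln b < 0\<close>.\<close>
  define t where "t = q - ln 2 / ln b"
  have tq: "q < t" using b by (simp add: t_def divide_pos_neg)
  have "b powr t = b powr q * b powr (- ln 2 / ln b)" by (simp add: t_def flip: powr_add)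
  also have "b powr (- ln 2 / ln b) = 1/2"
    using b by (simp add: powr_def exp_minus)
  finally have "2 * (real (card T) * b powr t) = real (card T) * b powr q" by simp
  then have "1 \<le> real (card T) * b powr t" using card unfolding b_def by linarith
  have "ennreal ((K * r * D) powr t) \<le> hausdorff_content t \<infinity> F"
  proof (rule compact_hausdorff_content_ge[OF compact_F])
    fix I :: "nat set" and U :: "nat \<Rightarrow> 'a set"
    assume I: "finite I" "F \<subseteq> (\<Union>i\<in>I. U i)" "\<And>i. i \<in> I \<Longrightarrow> bounded (U i)"
    show "(K * r * D) powr t \<le> (\<Sum>i\<in>I. diameter (U i) powr t)"
      by (rule separated_copies_finite_cover[of F T b _ t g, OF F_ne bounded_F T(1) b _ _ T(2) _ T(4) _ I])
        (use T(3) K r D_pos tq q \<open>1 \<le> real (card T) * b powr t\<close> in \<open>auto simp: b_def\<close>)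
  qed (use tq q in simp)
  also have "\<dots> \<le> hausdorff_measure t F" by (rule hausdorff_content_le_measure) simp
  finally have "ennreal ((K * r * D) powr t) \<le> hausdorff_measure t F" .
  moreover have "0 < ennreal ((K * r * D) powr t)" using r K D_pos by simp
  ultimately have "0 < hausdorff_measure t F" by (rule order_less_le_trans[rotated])
  then have "t \<le> s" using u by (rule hausdorff_dim_ge)
  then show ?thesis using tq by simp
qed

lemma dim_pos: "0 < s"
proof -
  obtain x y where xy: "x \<in> F" "y \<in> F" "x \<noteq> y" using nontrivial by blast
  \<comment> \<open>Packing balls then have diameter \<open>dist x y / 2\<close>, so none contains
    both points. This gives two copies, which is enough for \<open>dim_gt\<close> with exponent
    0.\<close>
  define r where "r = dist x y / (12 * K * D)"
  have r: "0 < r" "r \<le> 1" "6 * K * D * r < dist x y"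
  proof -
    have "dist x y \<le> K * D" using mult_mono[of 1 K "dist x y" D] K D_pos dist_le_D[OF xy(1,2)] by simp
    moreover have "0 < K * D" using K D_pos by simp
    ultimately show "r \<le> 1" unfolding r_def mult.assoc pos_divide_le_eq[of "12 * (K * D)"]
      by (simp add: divide_le_eq)
  qed (use xy K D_pos in \<open>auto simp: r_def field_simps\<close>)
  obtain T g where "separated_copies r T g" using packing_copies[OF r(1,2)] .
  note T = separated_copiesD[OF this]
  have "2 \<le> card T"
  proof -
    obtain t where "t \<in> T" "dist t x \<le> 3 * (K * r * D)" using T(3) xy(1) by (auto 4 4)
    moreover obtain t' where "t' \<in> T" "dist t' y \<le> 3 * (K * r * D)" using T(3) xy(2) by (auto 4 4)
    moreover note t = calculation
    have "t \<noteq> t'"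
    proof
      assume "t = t'"
      moreover have "dist x y \<le> dist t x + dist t y" by metric
      ultimately show False using t r(3) by (simp add: algebra_simps)
    qed
    then have "card {t, t'} = 2" by simp
    moreover have "card {t, t'} \<le> card T" using t T(1) by (intro card_mono) auto
    ultimately show ?thesis by simp
  qed
  then show ?thesis by (intro dim_gt[OF r(1,2) _ T(1,4,5,7)]) (use a r in simp_all)
qed

text \<open>An infinite measure makes the content at some scale exceed any given bound. Compared
  with the cost of one ball for each centre, this yields so many copies that \<open>dim_gt\<close>
  would apply with \<open>q = s\<close>.\<close>

lemma measure_finite: "hausdorff_measure s F < \<infinity>"
proof (rule ccontr)
  assume "\<not> ?thesis"
  then have inf: "hausdorff_measure s F = \<infinity>" by (simp add: not_less top_unique)
  \<comment> \<open>The value that turns the bound by packing balls into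
    \<open>2 \<le> card T * (a * r) powr s\<close>.\<close>
  define M where "M = 2 * (6 * K * D / a) powr s"
  have "ennreal M < (SUP \<delta>\<in>{0<..}. hausdorff_content s (ennreal \<delta>) F)"
    unfolding hausdorff_measure_eq_SUP[symmetric] inf by simp
  then obtain d :: real where d: "0 < d" "ennreal M < hausdorff_content s (ennreal d) F"
    by (auto simp: less_SUP_iff)
  define r where "r = min 1 (d / (6 * K * D))"
  have KD: "0 < 6 * K * D" using K D_pos by simp
  have r: "0 < r" "r \<le> 1" using d KD by (auto simp: r_def)
  have "r \<le> d / (6 * K * D)" by (simp add: r_def)
  then have rd: "6 * K * D * r \<le> d" using KD by (simp add: pos_le_divide_eq mult.commute)
  obtain T g where "separated_copies r T g" using packing_copies[OF r(1,2)] .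
  note T = separated_copiesD[OF this]
  note d(2)
  also have "hausdorff_content s (ennreal d) F \<le> hausdorff_content s (ennreal (6 * K * D * r)) F"
    by (rule hausdorff_content_antimono) (use rd in \<open>simp add: ennreal_leI\<close>)
  also have "\<dots> \<le> ennreal (card T * (6 * K * D * r) powr s)"
    by (rule content_le_card[OF T(1,3) r(1) dim_pos])
  finally have "M < card T * (6 * K * D * r) powr s"
    by (simp add: M_def ennreal_less_iff)
  also have "(6 * K * D * r) powr s = ((6 * K * D / a) * (a * r)) powr s"
    using a by (simp add: mult.assoc)
  also have "\<dots> = (6 * K * D / a) powr s * (a * r) powr s"
    by (rule powr_mult)
  finally have "(6 * K * D / a) powr s * 2 < (6 * K * D / a) powr s * (card T * (a * r) powr s)"
    by (simp add: M_def mult_ac)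
  then have "2 \<le> card T * (a * r) powr s" by (simp add: mult_less_cancel_left)
  then have "s < s" using dim_pos by (intro dim_gt[OF r(1,2) _ T(1,4,5,7)]) simp_all
  then show False by simp
qed

section \<open>The measure of a part of \<open>F\<close> against its diameter\<close>

text \<open>The restriction to \<open>F\<close> is again a metric outer measure. The Borel measure
  obtained from it supplies additivity over copies here, and later it is the measure that shows
  Ahlfors regularity.\<close>

lemma borel_hausdorff_measure:
  obtains M where "sets M = sets borel" "\<forall>A\<in>sets borel. emeasure M A = hausdorff_measure s (F \<inter> A)"
proof (rule metric_outer_measure_borel[of "\<lambda>A. hausdorff_measure s (F \<inter> A)"])
  show "hausdorff_measure s (F \<inter> {}) = 0" by simp
  show "hausdorff_measure s (F \<inter> A) \<le> hausdorff_measure s (F \<inter> B)" if "A \<subseteq> B" for A B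
    by (rule hausdorff_measure_mono) (use that in blast)
  show "hausdorff_measure s (F \<inter> (\<Union>n. A n)) \<le> (\<Sum>n. hausdorff_measure s (F \<inter> A n))" for A :: "nat \<Rightarrow> 'a set"
    unfolding Int_UN_distrib by (rule hausdorff_measure_Union_nat)
  show "hausdorff_measure s (F \<inter> A) + hausdorff_measure s (F \<inter> B) \<le> hausdorff_measure s (F \<inter> (A \<union> B))"
    if "0 < \<eta>" "\<And>x y. x \<in> A \<Longrightarrow> y \<in> B \<Longrightarrow> \<eta> \<le> dist x y" for A B :: "'a set" and \<eta> :: real
    unfolding Int_Un_distrib by (rule hausdorff_measure_separated[OF that(1)]) (use that(2) in blast)
qed (use that in blast)

text \<open>Cover \<open>F\<close> by single sets around the copies of \<open>E\<close>, and by an optimal cover of the rest.\<close>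

lemma measure_compact_le_copies:
  assumes E: "compact E" "E \<subseteq> F" and r: "0 < r" "r \<le> 1"
    and T: "separated_copies r T g"
  shows "enn2real (hausdorff_content s (ennreal (6 * K * D * r)) F)
      + card T * (a * r) powr s * enn2real (hausdorff_measure s E)
    \<le> enn2real (hausdorff_measure s F) + card T * (K * r * diameter E) powr s"
proof -
  let ?H = "hausdorff_measure s" and ?c = "hausdorff_content s (ennreal (6 * K * D * r))"
  note T = separated_copiesD[OF T]
  have KD: "0 < 6 * K * D * r" using K D_pos r by simp
  obtain M where sM: "sets M = sets borel" and eM: "\<forall>A\<in>sets borel. emeasure M A = ?H (F \<inter> A)"
    by (rule borel_hausdorff_measure)
  note M = sM eM[rule_format]
  have gE: "compact (g t ` E)" "g t ` E \<subseteq> F" if t: "t \<in> T" for t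
  proof -
    have "(K * r)-lipschitz_on F (g t)"
      by (rule lipschitz_onI) (use T(6)[OF t] K r in auto)
    then have "continuous_on E (g t)"
      using E(2) continuous_on_subset lipschitz_on_continuous_on by blast
    then show "compact (g t ` E)" using E(1) by (rule compact_continuous_image)
    show "g t ` E \<subseteq> F" using T(4)[OF t] E(2) by blast
  qed
  have disj: "disjoint_family_on (\<lambda>t. g t ` E) T"
    unfolding disjoint_family_on_def
  proof (intro ballI impI)
    fix t t' assume tt: "t \<in> T" "t' \<in> T" "t \<noteq> t'"
    have "0 < K * r * D" using K r D_pos by simp
    then have "g t v \<noteq> g t' w" if "v \<in> E" "w \<in> E" for v w
      using T(7)[OF tt subsetD[OF E(2) that(1)] subsetD[OF E(2) that(2)]] by auto
    then show "g t ` E \<inter> g t' ` E = {}" by blast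
  qed
  have gb: "g t ` E \<in> sets borel" if "t \<in> T" for t
    by (rule borel_compact) (rule gE(1)[OF that])
  \<comment> \<open>The images of \<open>E\<close> are compact, hence Borel, so the measure of
    \<open>F\<close> splits exactly into the measures of the copies and of the rest.\<close>
  define Z where "Z = (\<Union>t\<in>T. g t ` E)"
  have Zb: "Z \<in> sets borel" unfolding Z_def
    by (rule sets.finite_UN) (use T(1) gb in auto)
  have Z: "Z \<subseteq> F" using gE(2) unfolding Z_def by blast
  have fin: "?H A < top" if "A \<subseteq> F" for A
    using hausdorff_measure_mono[OF that, of s] measure_finite by (auto intro: order_le_less_trans)
  have cfin: "?c A < top" if "A \<subseteq> F" for A
    using hausdorff_content_le_measure[of "ennreal (6 * K * D * r)" s A] KD fin[OF that]
    by (auto intro: order_le_less_trans)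
  have "?H F = emeasure M UNIV" by (simp add: M(2))
  also have "\<dots> = emeasure M Z + emeasure M (UNIV - Z)"
    using Zb M(1) by (subst plus_emeasure) auto
  also have "emeasure M Z = (\<Sum>t\<in>T. emeasure M (g t ` E))" unfolding Z_def
    by (rule sum_emeasure[symmetric]) (use M(1) gb T(1) disj in auto)
  also have "\<dots> = (\<Sum>t\<in>T. ?H (g t ` E))"
    by (rule sum.cong) (use gE(2) gb in \<open>auto simp: M(2) Int_absorb1\<close>)
  also have "emeasure M (UNIV - Z) = ?H (F - Z)"
    using Zb by (subst M(2)) (auto simp: Diff_eq)
  finally have H_split: "?H F = (\<Sum>t\<in>T. ?H (g t ` E)) + ?H (F - Z)" .
  have lower: "card T * (a * r) powr s * enn2real (?H E) \<le> enn2real (\<Sum>t\<in>T. ?H (g t ` E))"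
  proof -
    have "(\<Sum>t\<in>T. ennreal ((a * r) powr s) * ?H E) \<le> (\<Sum>t\<in>T. ?H (g t ` E))"
    proof (rule sum_mono)
      fix t assume t: "t \<in> T"
      show "ennreal ((a * r) powr s) * ?H E \<le> ?H (g t ` E)"
      proof (rule hausdorff_measure_expanding_image[OF dim_pos])
        show "0 < a * r" using a r by simp
        fix x y assume "x \<in> E" "y \<in> E"
        then show "a * r * dist x y \<le> dist (g t x) (g t y)" using T(5)[OF t] E(2) by blast
      qed
    qed
    then have "enn2real (\<Sum>t\<in>T. ennreal ((a * r) powr s) * ?H E) \<le> enn2real (\<Sum>t\<in>T. ?H (g t ` E))"
      by (rule enn2real_mono) (use fin gE T(1) in \<open>auto simp: ennreal_sum_less_top\<close>)
    then show ?thesis by (simp add: enn2real_mult)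
  qed
  have split_real: "enn2real (?H F) = enn2real (\<Sum>t\<in>T. ?H (g t ` E)) + enn2real (?H (F - Z))"
    unfolding H_split by (rule enn2real_plus) (use fin gE T(1) in \<open>auto simp: ennreal_sum_less_top\<close>)
  have "?c F \<le> ?c (F - Z) + ?c Z"
    using hausdorff_content_Un[of s _ "F - Z" Z] Z by (simp add: Un_absorb2)
  also have "?c (F - Z) \<le> ?H (F - Z)"
    by (rule hausdorff_content_le_measure) (use KD in simp)
  also have "?c Z \<le> ennreal (card T * (K * r * diameter E) powr s)"
  proof -
    have "?c Z \<le> (\<Sum>t\<in>T. ?c (g t ` E))" unfolding Z_def
      by (rule hausdorff_content_UN_finite[OF T(1)])
    also have "\<dots> \<le> (\<Sum>t\<in>T. ennreal ((K * r * diameter E) powr s))"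
    proof (rule sum_mono)
      fix t assume t: "t \<in> T"
      have bE: "bounded E" using E(1) by (rule compact_imp_bounded)
      have img: "bounded (g t ` E)" "diameter (g t ` E) \<le> K * r * diameter E"
        using diameter_image_le[OF bE, of "K * r" "g t"] T(6)[OF t] E(2) K r by auto
      \<comment> \<open>A copy of \<open>E\<close> has to be admissible as a single covering set at
        scale \<open>6 * K * D * r\<close>.\<close>
      have "diameter E \<le> D" using E(2) bounded_F by (rule diameter_subset)
      then have "K * r * diameter E \<le> K * r * D" using K r by (intro mult_left_mono) auto
      moreover have "0 < K * r * D" using K r D_pos by simp
      moreover have "6 * K * D * r = 6 * (K * r * D)" by simp
      ultimately have small: "diameter (g t ` E) \<le> 6 * K * D * r" using img(2) by linarith
      have "?c (g t ` E) \<le> diam_pow s (g t ` E)"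
        by (rule hausdorff_content_le_diam_pow) (simp add: ediameter_def img(1) ennreal_leI small)
      also have "\<dots> = ennreal (diameter (g t ` E) powr s)"
        using img(1) by (simp add: diam_pow_pos[OF dim_pos])
      also have "\<dots> \<le> ennreal ((K * r * diameter E) powr s)"
        using img dim_pos diameter_ge_0[OF img(1)] by (intro ennreal_leI powr_mono2) auto
      finally show "?c (g t ` E) \<le> ennreal ((K * r * diameter E) powr s)" .
    qed
    also have "\<dots> = ennreal (card T * (K * r * diameter E) powr s)"
      by (simp add: ennreal_mult ennreal_of_nat_eq_real_of_nat)
    finally show ?thesis .
  qed
  finally have "?c F \<le> ?H (F - Z) + ennreal (card T * (K * r * diameter E) powr s)"
    by (simp add: add_left_mono add_right_mono)
  also have "\<dots> = ennreal (enn2real (?H (F - Z)) + card T * (K * r * diameter E) powr s)"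
    using fin[of "F - Z"] by (simp add: ennreal_plus)
  finally have "enn2real (?c F) \<le> enn2real (?H (F - Z)) + card T * (K * r * diameter E) powr s"
    by (simp add: enn2real_leI)
  then show ?thesis using lower split_real by linarith
qed

text \<open>If the bound fails, the estimate for the copies forces every content at scale
  \<open>6 * K * D * r\<close> to be at most \<open>h / (1 + Q)\<close> with a fixed
  \<open>Q > 0\<close>. These contents increase to \<open>h\<close> as \<open>r\<close> tends to 0,
  which is impossible for a positive finite \<open>h\<close>.\<close>

lemma measure_compact_le:
  assumes E: "compact E" "E \<subseteq> F" and pos: "0 < hausdorff_measure s F"
  shows "hausdorff_measure s E \<le> ennreal ((K / a * diameter E) powr s)"
proof (rule ccontr)
  define h where "h = enn2real (hausdorff_measure s F)"
  define e where "e = enn2real (hausdorff_measure s E)"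
  have hF: "hausdorff_measure s F = ennreal h" "0 < h"
    using measure_finite pos by (auto simp: h_def enn2real_positive_iff)
  have "hausdorff_measure s E \<le> hausdorff_measure s F" using E(2) by (rule hausdorff_measure_mono)
  then have eE: "hausdorff_measure s E = ennreal e"
    using measure_finite by (simp add: e_def ennreal_enn2real_if order_le_less_trans)
  \<comment> \<open>\<open>B * r powr s\<close> is the saving from one copy of \<open>E\<close>: its
    measure is at least \<open>(a * r) powr s * e\<close>, and a single covering set costs at most
    \<open>(K * r * diameter E) powr s\<close>.\<close>
  define B where "B = a powr s * e - K powr s * diameter E powr s"
  assume "\<not> ?thesis"
  then have "(K / a * diameter E) powr s < e" using eE
    by (simp add: not_le ennreal_less_iff)
  moreover have "a powr s * (K / a * diameter E) powr s = K powr s * diameter E powr s"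
    using a by (simp flip: powr_mult)
  moreover have "0 < a powr s" using a by simp
  ultimately have B: "0 < B" unfolding B_def
    by (metis diff_gt_0_iff_gt mult_strict_left_mono)
  \<comment> \<open>The saving from one copy divided by the cost of one packing ball. The powers of
    \<open>r\<close> cancel, so \<open>Q\<close> is the same at every scale.\<close>
  define Q where "Q = B / (6 * K * D) powr s"
  have KD: "0 < 6 * K * D" using K D_pos by simp
  then have pw: "0 < (6 * K * D) powr s" unfolding powr_gt_zero by linarith
  with B have Q: "0 < Q" unfolding Q_def by (rule divide_pos_pos)
  have QB: "(6 * K * D) powr s * Q = B"
    using pw unfolding Q_def times_divide_eq_right by (intro nonzero_mult_div_cancel_left) linarith
  have bound: "enn2real (hausdorff_content s (ennreal (6 * K * D * r)) F) * (1 + Q) \<le> h" if r: "0 < r" "r \<le> 1" for r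
  proof -
    obtain T g where T: "separated_copies r T g" using packing_copies[OF r] .
    define N where "N = real (card T)"
    define c where "c = enn2real (hausdorff_content s (ennreal (6 * K * D * r)) F)"
    have "hausdorff_content s (ennreal (6 * K * D * r)) F \<le> ennreal (N * (6 * K * D * r) powr s)"
      unfolding N_def by (rule content_le_card[OF separated_copiesD(1,3)[OF T] r(1) dim_pos])
    then have "c \<le> N * (6 * K * D * r) powr s" unfolding c_def
      by (rule enn2real_leI[rotated]) (simp add: N_def)
    also have "\<dots> = (6 * K * D) powr s * (N * r powr s)" by (simp add: powr_mult[of "6 * K * D" r])
    finally have "c \<le> (6 * K * D) powr s * (N * r powr s)" .
    then have "c * Q \<le> (6 * K * D) powr s * (N * r powr s) * Q" using Q by (intro mult_right_mono) auto
    also have "\<dots> = N * r powr s * B" unfolding QB[symmetric] by (simp only: ac_simps)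
    also have "\<dots> = N * (a * r) powr s * e - N * (K * r * diameter E) powr s"
      by (simp add: B_def powr_mult algebra_simps)
    finally show ?thesis using measure_compact_le_copies[OF E r T]
      unfolding c_def[symmetric] N_def[symmetric] e_def[symmetric] h_def[symmetric]
      by (simp add: algebra_simps)
  qed
  have "hausdorff_measure s F \<le> ennreal (h / (1 + Q))"
  proof (rule hausdorff_measure_leI)
    fix d :: real assume d: "0 < d"
    define r where "r = min 1 (d / (6 * K * D))"
    have r: "0 < r" "r \<le> 1" using d KD by (auto simp: r_def)
    have "r \<le> d / (6 * K * D)" by (simp add: r_def)
    then have rd: "6 * K * D * r \<le> d" using KD by (simp add: pos_le_divide_eq mult.commute)
    have "hausdorff_content s (ennreal d) F \<le> hausdorff_content s (ennreal (6 * K * D * r)) F"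
      by (rule hausdorff_content_antimono) (use rd in \<open>simp add: ennreal_leI\<close>)
    also have "\<dots> = ennreal (enn2real (hausdorff_content s (ennreal (6 * K * D * r)) F))"
    proof -
      have "hausdorff_content s (ennreal (6 * K * D * r)) F \<le> hausdorff_measure s F"
        by (rule hausdorff_content_le_measure) (use KD r in simp)
      then show ?thesis using measure_finite by (simp add: ennreal_enn2real_if order_le_less_trans)
    qed
    also have "\<dots> \<le> ennreal (h / (1 + Q))"
      using bound[OF r] Q by (intro ennreal_leI) (simp add: pos_le_divide_eq)
    finally show "hausdorff_content s (ennreal d) F \<le> ennreal (h / (1 + Q))" .
  qed
  then have "h \<le> h / (1 + Q)" using hF Q by simp
  then have "h * Q \<le> 0" using Q by (simp add: pos_le_divide_eq algebra_simps)
  then show False using hF(2) Q by (simp add: mult_le_0_iff)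
qed

text \<open>\<open>F \<inter> closure U\<close> is compact and no wider than \<open>U\<close>, so
  the compact case applies to it. The remaining cases are a null set \<open>F\<close> and a set
  \<open>U\<close> of infinite cost.\<close>

lemma measure_le_diam_pow:
  "hausdorff_measure s (F \<inter> U) \<le> ennreal ((K / a) powr s) * diam_pow s U"
proof -
  consider "hausdorff_measure s F = 0" | "\<not> bounded U" | "0 < hausdorff_measure s F" "bounded U"
    using not_gr_zero by blast
  then show ?thesis
  proof cases
    case 1
    have "hausdorff_measure s (F \<inter> U) \<le> hausdorff_measure s F" by (rule hausdorff_measure_mono) simp
    then show ?thesis using 1 by simp
  next
    case 2
    then show ?thesis using dim_pos a K by (simp add: diam_pow_pos ennreal_mult_top)
  next
    case 3
    have clb: "bounded (closure U)" using 3(2) by (rule bounded_closure)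
    have "hausdorff_measure s (F \<inter> U) \<le> hausdorff_measure s (F \<inter> closure U)"
      by (rule hausdorff_measure_mono) (use closure_subset in blast)
    also have "\<dots> \<le> ennreal ((K / a * diameter (F \<inter> closure U)) powr s)"
      by (rule measure_compact_le[OF _ _ 3(1)]) (use compact_F in auto)
    also have "\<dots> \<le> ennreal ((K / a * diameter U) powr s)"
    proof (intro ennreal_leI powr_mono2 mult_left_mono)
      have "diameter (F \<inter> closure U) \<le> diameter (closure U)" by (rule diameter_subset[OF _ clb]) simp
      then show "diameter (F \<inter> closure U) \<le> diameter U" using diameter_closure[OF 3(2)] by simp
      have "0 \<le> diameter (F \<inter> closure U)" by (rule diameter_ge_0) (use clb in auto)
      then show "0 \<le> K / a * diameter (F \<inter> closure U)" using K a by simp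
    qed (use K a dim_pos in auto)
    also have "\<dots> = ennreal ((K / a) powr s) * diam_pow s U"
      unfolding powr_mult using 3(2) by (simp add: diam_pow_pos[OF dim_pos] ennreal_mult)
    finally show ?thesis .
  qed
qed

lemma ratio_ge_1: "1 \<le> (K / a) powr s"
  using K a dim_pos by (intro ge_one_powr_ge_zero) auto

text \<open>The diameter bound is summed over a cover. It holds for sets of every size, so the cover
  is subject to no restriction on diameters, as the content at scale \<infinity> demands.\<close>

lemma measure_le_content:
  "hausdorff_measure s (F \<inter> A) \<le> ennreal ((K / a) powr s) * hausdorff_content s \<infinity> (F \<inter> A)"
proof -
  let ?k = "(K / a) powr s"
  have k: "ennreal ?k * ennreal (1 / ?k) = 1" using K a by (simp flip: ennreal_mult)
  have "ennreal (1 / ?k) * hausdorff_measure s (F \<inter> A) \<le> hausdorff_content s \<infinity> (F \<inter> A)"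
  proof (rule hausdorff_content_ge)
    fix U :: "nat \<Rightarrow> 'a set" assume U: "F \<inter> A \<subseteq> (\<Union>i. U i)"
    have "hausdorff_measure s (F \<inter> A) \<le> hausdorff_measure s (\<Union>i. F \<inter> U i)"
      by (rule hausdorff_measure_mono) (use U in blast)
    also have "\<dots> \<le> (\<Sum>i. hausdorff_measure s (F \<inter> U i))" by (rule hausdorff_measure_Union_nat)
    also have "\<dots> \<le> (\<Sum>i. ennreal ?k * diam_pow s (U i))" by (intro suminf_le measure_le_diam_pow) auto
    also have "\<dots> = ennreal ?k * (\<Sum>i. diam_pow s (U i))" by simp
    finally have "ennreal (1 / ?k) * hausdorff_measure s (F \<inter> A) \<le> ennreal (1 / ?k) * (ennreal ?k * (\<Sum>i. diam_pow s (U i)))"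
      by (rule mult_left_mono) simp
    also have "\<dots> = (ennreal ?k * ennreal (1 / ?k)) * (\<Sum>i. diam_pow s (U i))" by (simp only: ac_simps)
    finally show "ennreal (1 / ?k) * hausdorff_measure s (F \<inter> A) \<le> (\<Sum>i. diam_pow s (U i))" unfolding k by simp
  qed
  then have "ennreal ?k * (ennreal (1 / ?k) * hausdorff_measure s (F \<inter> A)) \<le> ennreal ?k * hausdorff_content s \<infinity> (F \<inter> A)"
    by (rule mult_left_mono) simp
  then show ?thesis unfolding mult.assoc[symmetric] k by simp
qed

end

section \<open>Ahlfors regularity\<close>

lemma finite_borel_measure_radon:
  fixes M :: "'a::euclidean_space measure"
  assumes M: "sets M = sets borel" and fin: "emeasure M UNIV < \<infinity>"
  shows "radon_measure M"
proof -
  have sp: "space M = UNIV" using sets_eq_imp_space_eq[OF M] by simp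
  have fin': "emeasure M (space M) \<noteq> \<infinity>" using fin sp by simp
  have "emeasure M K < \<infinity>" for K
    using emeasure_space[of M K] fin sp by (metis order_le_less_trans)
  then show ?thesis
    unfolding radon_measure_def
    using M inner_regular[OF M fin'] outer_regular[OF M fin'] by auto
qed

context quasi_self_similar
begin

lemma ediameter_F: "ediameter F = ennreal D"
  using bounded_F by (simp add: ediameter_def)

lemma measure_ball_le:
  assumes "0 < r"
  shows "hausdorff_measure s (F \<inter> cball x r) \<le> ennreal ((2 * K / a) powr s * r powr s)"
proof -
  have "hausdorff_measure s (F \<inter> cball x r) \<le> ennreal ((K / a) powr s) * diam_pow s (cball x r)"
    by (rule measure_le_diam_pow)
  also have "\<dots> = ennreal ((K / a) powr s * (2 * r) powr s)"
    using assms by (simp add: diam_pow_pos[OF dim_pos] ennreal_mult)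
  also have "(K / a) powr s * (2 * r) powr s = (2 * K / a) powr s * r powr s"
    unfolding powr_mult[symmetric] by (simp add: mult_ac)
  finally show ?thesis .
qed

text \<open>The ball contains the copy of \<open>F\<close> through \<open>x\<close> at scale
  \<open>q\<close>, whose measure is at least \<open>(a * q) powr s\<close> times that of
  \<open>F\<close>.\<close>

lemma measure_ball_ge:
  assumes x: "x \<in> F" and r: "0 < r" "r < D"
  shows "ennreal ((a / (K * D)) powr s * r powr s) * hausdorff_measure s F \<le> hausdorff_measure s (F \<inter> cball x r)"
proof -
  \<comment> \<open>Makes the diameter of the copy at most \<open>r\<close>; it is at most 1 because
    \<open>r < D\<close> and \<open>1 \<le> K\<close>.\<close>
  define q where "q = r / (K * D)"
  have KD: "0 < K * D" using K D_pos by simp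
  have "D \<le> K * D" using K D_pos by simp
  then have "r \<le> K * D" using r by linarith
  then have q: "0 < q" "q \<le> 1" using r KD unfolding q_def by (auto simp: divide_le_eq_1_pos)
  obtain g where g: "g ` F \<subseteq> F" "x \<in> g ` F" and
    gd: "\<forall>v\<in>F. \<forall>w\<in>F. a * q * dist v w \<le> dist (g v) (g w) \<and> dist (g v) (g w) \<le> K * q * dist v w"
    using local_copy[OF x q] by blast
  obtain p where p: "p \<in> F" "x = g p" using g(2) by blast
  have sub: "g ` F \<subseteq> F \<inter> cball x r"
  proof (rule image_subsetI)
    fix v assume v: "v \<in> F"
    have "dist x (g v) \<le> K * q * dist p v" using gd p v by blast
    also have "\<dots> \<le> K * q * D" using dist_le_D[OF p(1) v] K q by (intro mult_left_mono) auto
    also have "\<dots> = r" using K D_pos by (auto simp: q_def)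
    finally show "g v \<in> F \<inter> cball x r" using g(1) v by auto
  qed
  have "ennreal ((a * q) powr s) * hausdorff_measure s F \<le> hausdorff_measure s (g ` F)"
    by (rule hausdorff_measure_expanding_image[OF dim_pos]) (use a q gd in auto)
  also have "\<dots> \<le> hausdorff_measure s (F \<inter> cball x r)" by (rule hausdorff_measure_mono[OF sub])
  also have "(a * q) powr s = (a / (K * D)) powr s * r powr s"
    unfolding powr_mult[symmetric] by (simp add: q_def)
  finally show ?thesis .
qed

lemma measure_pos_imp_ahlfors_regular:
  assumes pos: "0 < hausdorff_measure s F"
  shows "ahlfors_regular s F"
proof -
  obtain M where sM: "sets M = sets borel" and eM: "\<forall>A\<in>sets borel. emeasure M A = hausdorff_measure s (F \<inter> A)"
    by (rule borel_hausdorff_measure)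
  define h where "h = enn2real (hausdorff_measure s F)"
  have hF: "hausdorff_measure s F = ennreal h" "0 < h"
    using measure_finite pos by (auto simp: h_def enn2real_positive_iff)
  have Fb: "F \<in> sets borel" using compact_F by (rule borel_compact)
  have fin: "emeasure M UNIV < \<infinity>" using eM measure_finite by simp
  define L where "L = (a / (K * D)) powr s * h"
  have "a / (K * D) \<noteq> 0" using a K D_pos by simp
  then have "0 < (a / (K * D)) powr s" unfolding powr_gt_zero .
  then have L: "0 < L" unfolding L_def using hF(2) by (rule mult_pos_pos)
  define C where "C = max 1 (max ((2 * K / a) powr s) (1 / L))"
  have C: "1 \<le> C" "(2 * K / a) powr s \<le> C" "1 / L \<le> C" by (auto simp: C_def)
  have iC: "inverse C \<le> L" using C(1,3) L by (simp add: field_simps)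
  have "radon_measure M" using sM fin by (rule finite_borel_measure_radon)
  moreover have "AE x in M. x \<in> F"
  proof (rule AE_I[of _ _ "- F"])
    show "emeasure M (- F) = 0" using eM Fb by simp
    show "- F \<in> sets M" using sM Fb by auto
  qed auto
  moreover have "ennreal (inverse C * r powr s) \<le> emeasure M (cball x r)
      \<and> emeasure M (cball x r) \<le> ennreal (C * r powr s)"
    if x: "x \<in> F" and r: "0 < r" "ennreal r < ediameter F" for x r
  proof
    have rD: "r < D" using r ediameter_F D_pos by (simp add: ennreal_less_iff)
    have e: "emeasure M (cball x r) = hausdorff_measure s (F \<inter> cball x r)" using eM by simp
    have "ennreal (inverse C * r powr s) \<le> ennreal (L * r powr s)"
      by (intro ennreal_leI mult_right_mono iC) simp
    also have "\<dots> = ennreal ((a / (K * D)) powr s * r powr s) * hausdorff_measure s F"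
      using hF by (simp add: L_def mult_ac flip: ennreal_mult)
    also have "\<dots> \<le> emeasure M (cball x r)" unfolding e by (rule measure_ball_ge[OF x r(1) rD])
    finally show "ennreal (inverse C * r powr s) \<le> emeasure M (cball x r)" .
    have "emeasure M (cball x r) \<le> ennreal ((2 * K / a) powr s * r powr s)"
      unfolding e by (rule measure_ball_le[OF r(1)])
    also have "\<dots> \<le> ennreal (C * r powr s)" by (intro ennreal_leI mult_right_mono C(2)) simp
    finally show "emeasure M (cball x r) \<le> ennreal (C * r powr s)" .
  qed
  ultimately show ?thesis unfolding ahlfors_regular_def using C(1) by blast
qed

text \<open>Mass distribution principle: a cover of \<open>F\<close> has to carry the mass of a
  fixed ball, and a covering set that meets \<open>F\<close> lies in a ball centred in
  \<open>F\<close>, whose mass is controlled by its radius.\<close>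

lemma ahlfors_regular_imp_measure_pos:
  assumes "ahlfors_regular s F"
  shows "0 < hausdorff_measure s F"
proof -
  obtain \<mu> :: "'a measure" and C :: real where rad: "radon_measure \<mu>" and AE: "AE x in \<mu>. x \<in> F" and C: "1 \<le> C"
    and ball: "\<forall>x\<in>F. \<forall>r. 0 < r \<and> ennreal r < ediameter F \<longrightarrow>
           ennreal (inverse C * r powr s) \<le> emeasure \<mu> (cball x r) \<and>
           emeasure \<mu> (cball x r) \<le> ennreal (C * r powr s)"
    using assms unfolding ahlfors_regular_def by blast
  have sets: "sets \<mu> = sets borel" using rad by (simp add: radon_measure_def)
  have lt_D: "ennreal r < ediameter F" if "0 < r" "r < D" for r
    using that unfolding ediameter_F by (simp add: ennreal_less_iff)
  obtain p where p: "p \<in> F" using F_ne by blast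
  \<comment> \<open>The ball bounds are available only for radii below \<open>D\<close>; half of it
    is one such radius.\<close>
  define m where "m = inverse C * (D / 2) powr s"
  have m: "0 < m" using C D_pos by (simp add: m_def)
  have m_le: "ennreal m \<le> emeasure \<mu> (cball p (D / 2))"
    using ball p D_pos lt_D[of "D / 2"] unfolding m_def by simp
  \<comment> \<open>The first term of the minimum accounts for covers containing a set of diameter
    at least \<open>D\<close>, to which no ball bound applies.\<close>
  have "ennreal (min (D powr s) (m / C)) \<le> hausdorff_content s \<infinity> F"
  proof (rule compact_hausdorff_content_ge[OF compact_F dim_pos])
    fix I :: "nat set" and U :: "nat \<Rightarrow> 'a set"
    assume I: "finite I" "F \<subseteq> (\<Union>i\<in>I. U i)" "\<And>i. i \<in> I \<Longrightarrow> bounded (U i)"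
    show "min (D powr s) (m / C) \<le> (\<Sum>i\<in>I. diameter (U i) powr s)"
    proof (cases "\<exists>i\<in>I. D \<le> diameter (U i)")
      case True
      then obtain i where i: "i \<in> I" "D \<le> diameter (U i)" by blast
      have "D powr s \<le> diameter (U i) powr s" using i D_pos dim_pos by (intro powr_mono2) auto
      also have "\<dots> \<le> (\<Sum>i\<in>I. diameter (U i) powr s)" by (rule member_le_sum) (use i I in auto)
      finally show ?thesis by simp
    next
      case False
      then have small: "\<And>i. i \<in> I \<Longrightarrow> diameter (U i) < D" by force
      \<comment> \<open>A covering set may have diameter 0 while the ball bounds ask for positive
        radii, so the radii are enlarged by \<open>d\<close>, which then tends to 0.\<close>
      have bound: "m \<le> C * (\<Sum>i\<in>I. (diameter (U i) + d) powr s)"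
        if d: "0 < d" "\<forall>i\<in>I. diameter (U i) + d < D" for d
      proof -
        define J where "J = {i \<in> I. U i \<inter> F \<noteq> {}}"
        have "\<forall>i\<in>J. \<exists>x. x \<in> U i \<inter> F" by (auto simp: J_def)
        then obtain x where x: "\<And>i. i \<in> J \<Longrightarrow> x i \<in> U i \<inter> F" by metis
        have J: "finite J" "J \<subseteq> I" using I(1) by (auto simp: J_def)
        have cov: "F \<subseteq> (\<Union>i\<in>J. cball (x i) (diameter (U i) + d))"
        proof
          fix y assume y: "y \<in> F"
          then obtain i where i: "i \<in> I" "y \<in> U i" using I(2) by blast
          then have iJ: "i \<in> J" using y by (auto simp: J_def)
          have "dist (x i) y \<le> diameter (U i)"
            using diameter_bounded_bound[OF I(3)[OF i(1)]] x[OF iJ] i(2) by blast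
          then have "y \<in> cball (x i) (diameter (U i) + d)" using d by simp
          then show "y \<in> (\<Union>i\<in>J. cball (x i) (diameter (U i) + d))" using iJ by blast
        qed
        note m_le
        also have "emeasure \<mu> (cball p (D / 2)) \<le> emeasure \<mu> (\<Union>i\<in>J. cball (x i) (diameter (U i) + d))"
        proof (rule emeasure_mono_AE)
          show "AE y in \<mu>. y \<in> cball p (D / 2) \<longrightarrow> y \<in> (\<Union>i\<in>J. cball (x i) (diameter (U i) + d))"
            using AE by eventually_elim (use cov in blast)
          show "(\<Union>i\<in>J. cball (x i) (diameter (U i) + d)) \<in> sets \<mu>"
            unfolding sets by (rule sets.finite_UN[OF J(1)]) simp
        qed
        also have "\<dots> \<le> (\<Sum>i\<in>J. emeasure \<mu> (cball (x i) (diameter (U i) + d)))"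
          by (rule emeasure_subadditive_finite[OF J(1)]) (auto simp: sets)
        also have "\<dots> \<le> (\<Sum>i\<in>J. ennreal (C * (diameter (U i) + d) powr s))"
        proof (rule sum_mono)
          fix i assume i: "i \<in> J"
          have "0 < diameter (U i) + d" using diameter_ge_0[OF I(3)] i J d by (meson add_nonneg_pos subsetD)
          then show "emeasure \<mu> (cball (x i) (diameter (U i) + d)) \<le> ennreal (C * (diameter (U i) + d) powr s)"
            using ball x[OF i] lt_D d(2) i J(2) by blast
        qed
        also have "\<dots> \<le> (\<Sum>i\<in>I. ennreal (C * (diameter (U i) + d) powr s))"
          by (rule sum_mono2[OF I(1) J(2)]) simp
        also have "\<dots> = ennreal (C * (\<Sum>i\<in>I. (diameter (U i) + d) powr s))"
          unfolding sum_distrib_left using C by (intro sum_ennreal) simp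
        finally show ?thesis using C by (simp add: sum_nonneg)
      qed
      have "((\<lambda>d. C * (\<Sum>i\<in>I. (diameter (U i) + d) powr s)) \<longlongrightarrow> C * (\<Sum>i\<in>I. (diameter (U i) + 0) powr s)) (at_right 0)"
      proof (intro tendsto_mult tendsto_const tendsto_sum tendsto_powr')
        fix i assume i: "i \<in> I"
        have g: "0 \<le> diameter (U i)" using diameter_ge_0[OF I(3)[OF i]] .
        show "((\<lambda>d. diameter (U i) + d) \<longlongrightarrow> diameter (U i) + 0) (at_right 0)"
          by (intro tendsto_intros)
        have "\<forall>\<^sub>F d in at_right 0. 0 \<le> diameter (U i) + d"
          using eventually_at_right_less[of "0::real"] by eventually_elim (use g in simp)
        then show "diameter (U i) + 0 \<noteq> 0 \<or> 0 < s \<and> (\<forall>\<^sub>F d in at_right 0. 0 \<le> diameter (U i) + d)"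
          using dim_pos by blast
      qed
      moreover have "\<forall>\<^sub>F d in at_right 0. m \<le> C * (\<Sum>i\<in>I. (diameter (U i) + d) powr s)"
      proof -
        have "\<forall>\<^sub>F d in at_right 0. \<forall>i\<in>I. diameter (U i) + d < D"
        proof (rule eventually_ball_finite[OF I(1)], rule ballI)
          fix i assume "i \<in> I"
          then have "0 < D - diameter (U i)" using small by simp
          from eventually_at_right_real[OF this] show "\<forall>\<^sub>F d in at_right 0. diameter (U i) + d < D"
            by eventually_elim auto
        qed
        with eventually_at_right_less[of "0::real"] show ?thesis
          by eventually_elim (rule bound)
      qed
      ultimately have "m \<le> C * (\<Sum>i\<in>I. (diameter (U i) + 0) powr s)"
        by (rule tendsto_lowerbound) simp
      then have "m / C \<le> (\<Sum>i\<in>I. diameter (U i) powr s)" using C by (simp add: divide_le_eq mult.commute)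
      then show ?thesis by simp
    qed
  qed
  also have "\<dots> \<le> hausdorff_measure s F" by (rule hausdorff_content_le_measure) simp
  finally have "ennreal (min (D powr s) (m / C)) \<le> hausdorff_measure s F" .
  moreover have "0 < ennreal (min (D powr s) (m / C))" using m C D_pos by simp
  ultimately show ?thesis by (rule order_less_le_trans[rotated])
qed

end

section \<open>Bounded distortion\<close>

text \<open>\<open>L i z\<close> stands for the norm of the differential of \<open>\<phi> i\<close>
  at \<open>z\<close>, and \<open>e n\<close> bounds the logarithmic distortion within distance
  \<open>\<kappa> ^ n * diameter F\<close>. The reference point \<open>z\<close> may differ from
  \<open>x\<close> and \<open>y\<close>, so that a whole word can be measured at one base
  point.\<close>

locale bounded_distortion =
  fixes F :: "'a::euclidean_space set" and I :: "nat set" and \<phi> :: "nat \<Rightarrow> 'a \<Rightarrow> 'a"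
    and L :: "nat \<Rightarrow> 'a \<Rightarrow> real" and \<kappa> m :: real and e :: "nat \<Rightarrow> real"
  assumes compact_F: "compact F" and nontrivial: "\<exists>x\<in>F. \<exists>y\<in>F. x \<noteq> y"
    and finite_I: "finite I" and F_eq: "F = (\<Union>i\<in>I. \<phi> i ` F)"
    and \<kappa>: "0 < \<kappa>" "\<kappa> < 1" and m: "0 < m"
    and contracting: "\<And>i x y. i \<in> I \<Longrightarrow> x \<in> F \<Longrightarrow> y \<in> F \<Longrightarrow> dist (\<phi> i x) (\<phi> i y) \<le> \<kappa> * dist x y"
    and expanding: "\<And>i x y. i \<in> I \<Longrightarrow> x \<in> F \<Longrightarrow> y \<in> F \<Longrightarrow> m * dist x y \<le> dist (\<phi> i x) (\<phi> i y)"
    and L_pos: "\<And>i x. i \<in> I \<Longrightarrow> x \<in> F \<Longrightarrow> 0 < L i x"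
    and e: "summable e" "\<And>n. 0 \<le> e n"
    and distort: "\<And>i x y z n. i \<in> I \<Longrightarrow> x \<in> F \<Longrightarrow> y \<in> F \<Longrightarrow> z \<in> F \<Longrightarrow>
      dist x y \<le> \<kappa> ^ n * diameter F \<Longrightarrow> dist x z \<le> \<kappa> ^ n * diameter F \<Longrightarrow>
      dist (\<phi> i x) (\<phi> i y) \<le> L i z * dist x y * exp (e n) \<and>
      L i z * dist x y \<le> dist (\<phi> i x) (\<phi> i y) * exp (e n)"
begin

primrec word_map :: "nat list \<Rightarrow> 'a \<Rightarrow> 'a" where
  "word_map [] x = x"
| "word_map (i # w) x = \<phi> i (word_map w x)"

text \<open>By the chain rule this is the norm of the differential of \<open>word_map w\<close> at \<open>p\<close>.\<close>

primrec word_scale :: "'a \<Rightarrow> nat list \<Rightarrow> real" where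
  "word_scale p [] = 1"
| "word_scale p (i # w) = L i (word_map w p) * word_scale p w"

section \<open>Distortion along words\<close>

lemma image_subset: "i \<in> I \<Longrightarrow> \<phi> i ` F \<subseteq> F"
  using F_eq by blast

lemma word_map_in: "set w \<subseteq> I \<Longrightarrow> x \<in> F \<Longrightarrow> word_map w x \<in> F"
  by (induction w) (use image_subset in auto)

lemma word_map_append: "word_map (v @ w) x = word_map v (word_map w x)"
  by (induction v) auto

lemma word_map_contracting:
  "set w \<subseteq> I \<Longrightarrow> x \<in> F \<Longrightarrow> y \<in> F \<Longrightarrow> dist (word_map w x) (word_map w y) \<le> \<kappa> ^ length w * dist x y"
proof (induction w)
  case (Cons i w)
  have "dist (word_map (i # w) x) (word_map (i # w) y) \<le> \<kappa> * dist (word_map w x) (word_map w y)"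
    using Cons.prems contracting word_map_in by simp
  also have "\<dots> \<le> \<kappa> * (\<kappa> ^ length w * dist x y)"
    using Cons \<kappa> by (intro mult_left_mono) auto
  finally show ?case by (simp add: mult.assoc)
qed simp

lemma dist_le_diameter: "x \<in> F \<Longrightarrow> y \<in> F \<Longrightarrow> dist x y \<le> diameter F"
  by (rule diameter_bounded_bound[OF compact_imp_bounded[OF compact_F]])

lemma word_scale_pos: "set w \<subseteq> I \<Longrightarrow> p \<in> F \<Longrightarrow> 0 < word_scale p w"
  by (induction w) (auto intro!: mult_pos_pos L_pos word_map_in)

text \<open>The front letter acts last, on the image of \<open>F\<close> under
  \<open>word_map w\<close>, which has diameter at most
  \<open>\<kappa> ^ length w * diameter F\<close>. It contributes the error
  \<open>e (length w)\<close>, and the errors of all letters add up to a partial sum of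
  \<open>e\<close>.\<close>

lemma word_map_distortion:
  assumes "p \<in> F" "x \<in> F" "y \<in> F"
  shows "set w \<subseteq> I \<Longrightarrow>
    dist (word_map w x) (word_map w y) \<le> word_scale p w * dist x y * exp (\<Sum>k<length w. e k) \<and>
    word_scale p w * dist x y \<le> dist (word_map w x) (word_map w y) * exp (\<Sum>k<length w. e k)"
proof (induction w)
  case (Cons i w)
  define X where "X = word_map w x"
  define Y where "Y = word_map w y"
  define Z where "Z = word_map w p"
  define S where "S = (\<Sum>k<length w. e k)"
  have w: "i \<in> I" "set w \<subseteq> I" using Cons.prems by auto
  have XYZ: "X \<in> F" "Y \<in> F" "Z \<in> F" using assms w word_map_in by (auto simp: X_def Y_def Z_def)
  have near: "dist (word_map w x) (word_map w q) \<le> \<kappa> ^ length w * diameter F" if "q \<in> F" for q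
  proof -
    have "dist (word_map w x) (word_map w q) \<le> \<kappa> ^ length w * dist x q"
      by (rule word_map_contracting[OF w(2) assms(2) that])
    also have "\<dots> \<le> \<kappa> ^ length w * diameter F"
      using dist_le_diameter[OF assms(2) that] \<kappa> by (intro mult_left_mono) auto
    finally show ?thesis .
  qed
  have IH: "dist X Y \<le> word_scale p w * dist x y * exp S" "word_scale p w * dist x y \<le> dist X Y * exp S"
    using Cons.IH[OF w(2)] by (simp_all add: X_def Y_def S_def)
  have step: "dist (\<phi> i X) (\<phi> i Y) \<le> L i Z * dist X Y * exp (e (length w))"
    "L i Z * dist X Y \<le> dist (\<phi> i X) (\<phi> i Y) * exp (e (length w))"
    using distort[OF w(1) XYZ, of "length w"] near assms by (simp_all add: X_def Y_def Z_def)
  have LZ: "0 \<le> L i Z" using L_pos[OF w(1) XYZ(3)] by simp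
  have sum: "exp (\<Sum>k<length (i # w). e k) = exp S * exp (e (length w))"
    by (simp add: S_def exp_add)
  have "L i Z * dist X Y * exp (e (length w)) \<le> L i Z * (word_scale p w * dist x y * exp S) * exp (e (length w))"
    using IH(1) LZ by (intro mult_right_mono mult_left_mono) auto
  with step(1) have up: "dist (\<phi> i X) (\<phi> i Y) \<le> L i Z * (word_scale p w * dist x y * exp S) * exp (e (length w))"
    by (rule order_trans)
  have "L i Z * (word_scale p w * dist x y) \<le> L i Z * (dist X Y * exp S)"
    using IH(2) LZ by (rule mult_left_mono)
  also have "\<dots> = (L i Z * dist X Y) * exp S" by simp
  also have "\<dots> \<le> (dist (\<phi> i X) (\<phi> i Y) * exp (e (length w))) * exp S"
    using step(2) by (intro mult_right_mono) auto
  finally show ?case using up unfolding sum by (simp add: X_def Y_def Z_def mult_ac)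
qed simp

text \<open>Uniform distortion constant: it bounds the exponential of every partial sum of
  \<open>e\<close>, hence the distortion of words of any length.\<close>

definition "G = exp (suminf e)"

lemma G_ge_1: "1 \<le> G"
  unfolding G_def using suminf_nonneg[OF e] by simp

lemma exp_sum_le_G: "exp (\<Sum>k<n. e k) \<le> G"
  unfolding G_def using sum_le_suminf[OF e(1), of "{..<n}"] e(2) by simp

lemma word_map_le:
  assumes "set w \<subseteq> I" "p \<in> F" "x \<in> F" "y \<in> F"
  shows "dist (word_map w x) (word_map w y) \<le> G * (word_scale p w * dist x y)"
proof -
  have "dist (word_map w x) (word_map w y) \<le> (word_scale p w * dist x y) * exp (\<Sum>k<length w. e k)"
    using word_map_distortion[OF assms(2-4,1)] by simp
  also have "\<dots> \<le> (word_scale p w * dist x y) * G"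
    using exp_sum_le_G word_scale_pos[OF assms(1,2)] by (intro mult_left_mono) auto
  finally show ?thesis by (simp add: mult.commute)
qed

lemma word_map_ge:
  assumes "set w \<subseteq> I" "p \<in> F" "x \<in> F" "y \<in> F"
  shows "word_scale p w * dist x y \<le> G * dist (word_map w x) (word_map w y)"
proof -
  have "word_scale p w * dist x y \<le> dist (word_map w x) (word_map w y) * exp (\<Sum>k<length w. e k)"
    using word_map_distortion[OF assms(2-4,1)] by simp
  also have "\<dots> \<le> dist (word_map w x) (word_map w y) * G"
    using exp_sum_le_G by (intro mult_left_mono) auto
  finally show ?thesis by (simp add: mult.commute)
qed

text \<open>The scale is tested on one pair of distinct points, whose images are close by
  contraction.\<close>

lemma word_scale_le:
  assumes "set w \<subseteq> I" "p \<in> F"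
  shows "word_scale p w \<le> G * \<kappa> ^ length w"
proof -
  obtain x y where xy: "x \<in> F" "y \<in> F" "x \<noteq> y" using nontrivial by blast
  have "word_scale p w * dist x y \<le> G * dist (word_map w x) (word_map w y)"
    by (rule word_map_ge[OF assms xy(1,2)])
  also have "\<dots> \<le> G * (\<kappa> ^ length w * dist x y)"
    using word_map_contracting[OF assms(1) xy(1,2)] G_ge_1 by (intro mult_left_mono) auto
  finally have "word_scale p w * dist x y \<le> (G * \<kappa> ^ length w) * dist x y" by (simp add: mult.assoc)
  then show ?thesis by (rule mult_right_le_imp_le) (use xy in simp)
qed

text \<open>The added letter acts first and moves the base point, so the two scales are compared
  through images of one pair of points. \<open>word_map_ge\<close> for \<open>w\<close> and
  \<open>word_map_le\<close> for the longer word each cost a factor \<open>G\<close>.\<close>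

lemma word_scale_snoc_ge:
  assumes "set w \<subseteq> I" "i \<in> I" "p \<in> F"
  shows "m / G\<^sup>2 * word_scale p w \<le> word_scale p (w @ [i])"
proof -
  obtain x y where xy: "x \<in> F" "y \<in> F" "x \<noteq> y" using nontrivial by blast
  have im: "\<phi> i x \<in> F" "\<phi> i y \<in> F" using image_subset[OF assms(2)] xy by auto
  have wi: "set (w @ [i]) \<subseteq> I" using assms by simp
  have "m * word_scale p w * dist x y = word_scale p w * (m * dist x y)" by simp
  also have "\<dots> \<le> word_scale p w * dist (\<phi> i x) (\<phi> i y)"
    using expanding[OF assms(2) xy(1,2)] word_scale_pos[OF assms(1,3)] by (intro mult_left_mono) auto
  also have "\<dots> \<le> G * dist (word_map (w @ [i]) x) (word_map (w @ [i]) y)"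
    unfolding word_map_append using word_map_ge[OF assms(1,3) im] by simp
  also have "\<dots> \<le> G * (G * (word_scale p (w @ [i]) * dist x y))"
    using word_map_le[OF wi assms(3) xy(1,2)] G_ge_1 by (intro mult_left_mono) auto
  finally have "(m * word_scale p w) * dist x y \<le> (G\<^sup>2 * word_scale p (w @ [i])) * dist x y"
    by (simp add: power2_eq_square mult_ac)
  then have "m * word_scale p w \<le> G\<^sup>2 * word_scale p (w @ [i])"
    by (rule mult_right_le_imp_le) (use xy in simp)
  moreover have "0 < G\<^sup>2" using G_ge_1 by simp
  ultimately show ?thesis by (simp add: pos_divide_le_eq mult.commute)
qed

lemma exists_word:
  assumes "x \<in> F"
  shows "\<exists>w. length w = n \<and> set w \<subseteq> I \<and> x \<in> word_map w ` F"
proof (induction n)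
  case 0
  show ?case using assms by (intro exI[of _ "[]"]) auto
next
  case (Suc n)
  then obtain w y where w: "length w = n" "set w \<subseteq> I" "y \<in> F" "x = word_map w y" by blast
  obtain i z where i: "i \<in> I" "z \<in> F" "y = \<phi> i z" using w(3) F_eq by blast
  then have "x = word_map (w @ [i]) z" using w(4) by (simp add: word_map_append)
  then show ?case using w i by (intro exI[of _ "w @ [i]"]) auto
qed

text \<open>A shortest word with scale at most \<open>r\<close> is taken. Its scale is not much
  smaller than \<open>r\<close>: dropping the last letter leaves a word whose image still contains
  \<open>x\<close>, so its scale must exceed \<open>r\<close>. The empty word has scale 1, which is
  at least \<open>r\<close>.\<close>

lemma exists_word_of_scale:
  assumes p: "p \<in> F" and x: "x \<in> F" and r: "0 < r" "r \<le> 1"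
  obtains w where "set w \<subseteq> I" "x \<in> word_map w ` F" "word_scale p w \<le> r" "min 1 (m / G\<^sup>2) * r \<le> word_scale p w"
proof -
  define P where "P w \<longleftrightarrow> set w \<subseteq> I \<and> x \<in> word_map w ` F \<and> word_scale p w \<le> r" for w
  have "\<exists>w. P w"
  proof -
    have "0 < r / G" using r G_ge_1 by simp
    then obtain n where n: "\<kappa> ^ n < r / G" using real_arch_pow_inv \<kappa> by blast
    obtain w where w: "length w = n" "set w \<subseteq> I" "x \<in> word_map w ` F" using exists_word[OF x] by blast
    have "word_scale p w \<le> G * \<kappa> ^ n" using word_scale_le[OF w(2) p] w(1) by simp
    also have "\<dots> \<le> r" using n G_ge_1 by (simp add: pos_less_divide_eq mult.commute)
    finally show ?thesis using w by (auto simp: P_def)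
  qed
  then obtain w where w: "P w" and min: "\<And>v. P v \<Longrightarrow> length w \<le> length v"
    using ex_has_least_nat[of P _ length] by blast
  have "min 1 (m / G\<^sup>2) * r \<le> word_scale p w"
  proof (cases w rule: rev_cases)
    case Nil
    have "min 1 (m / G\<^sup>2) * r \<le> 1 * r" using r by (intro mult_right_mono) auto
    also have "1 * r \<le> word_scale p w" using Nil r by simp
    finally show ?thesis .
  next
    case (snoc u i)
    have ui: "set u \<subseteq> I" "i \<in> I" using w snoc by (auto simp: P_def)
    have "x \<in> word_map u ` F"
    proof -
      obtain z where "z \<in> F" "x = word_map u (\<phi> i z)" using w snoc by (auto simp: P_def word_map_append)
      then show ?thesis using image_subset[OF ui(2)] by blast
    qed
    moreover have "\<not> P u" using min[of u] snoc by auto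
    ultimately have big: "r < word_scale p u" using ui(1) by (auto simp: P_def)
    have "min 1 (m / G\<^sup>2) * r \<le> m / G\<^sup>2 * r" using r by (intro mult_right_mono) auto
    also have "\<dots> \<le> m / G\<^sup>2 * word_scale p u" using big m by (intro mult_left_mono) auto
    also have "\<dots> \<le> word_scale p w" unfolding snoc by (rule word_scale_snoc_ge[OF ui p])
    finally show ?thesis .
  qed
  then show ?thesis using that w by (auto simp: P_def)
qed

text \<open>For \<open>u\<close> so large that \<open>card I * \<kappa> powr u \<le> 1 / 2\<close>,
  the invariance of \<open>F\<close> gives \<open>c \<le> c / 2\<close> for its content. The content
  is finite since \<open>F\<close> is bounded, so it vanishes.\<close>

lemma measure_zero:
  obtains u where "0 \<le> u" "hausdorff_measure u F = 0"
proof -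
  have "0 < 1 / (2 * (real (card I) + 1))" by simp
  then obtain k where k: "\<kappa> ^ k < 1 / (2 * (real (card I) + 1))" using real_arch_pow_inv \<kappa> by blast
  define u where "u = real (Suc k)"
  have u: "0 < u" by (simp add: u_def)
  have "\<kappa> powr u = \<kappa> ^ Suc k" using \<kappa>(1) unfolding u_def by (rule powr_realpow)
  also have "\<dots> \<le> \<kappa> ^ k" using \<kappa> by (simp add: mult_left_le_one_le)
  also note k
  finally have ku: "\<kappa> powr u < 1 / (2 * (real (card I) + 1))" .
  have "real (card I) * \<kappa> powr u \<le> (real (card I) + 1) * (1 / (2 * (real (card I) + 1)))"
    using ku by (intro mult_mono) auto
  also have "\<dots> = 1 / 2" by (simp add: field_simps)
  finally have half: "real (card I) * \<kappa> powr u \<le> 1 / 2" .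
  define c where "c = hausdorff_content u \<infinity> F"
  have "c = hausdorff_content u \<infinity> (\<Union>i\<in>I. \<phi> i ` F)" unfolding c_def using F_eq by metis
  also have "\<dots> \<le> (\<Sum>i\<in>I. hausdorff_content u \<infinity> (\<phi> i ` F))" by (rule hausdorff_content_UN_finite[OF finite_I])
  also have "\<dots> \<le> (\<Sum>i\<in>I. ennreal (\<kappa> powr u) * c)" unfolding c_def
    by (intro sum_mono hausdorff_content_lipschitz_image[OF u \<kappa>(1)] contracting) auto
  also have "\<dots> = ennreal (real (card I) * \<kappa> powr u) * c"
    by (simp add: ennreal_mult ennreal_of_nat_eq_real_of_nat mult.assoc)
  also have "\<dots> \<le> ennreal (1 / 2) * c" by (intro mult_right_mono ennreal_leI half) simp
  finally have c: "c \<le> ennreal (1 / 2) * c" .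
  have bF: "bounded F" using compact_F by (rule compact_imp_bounded)
  have "c \<le> diam_pow u F" unfolding c_def by (rule hausdorff_content_le_diam_pow) simp
  also have "\<dots> < top" using u bF by (simp add: diam_pow_pos)
  finally obtain b where b: "c = ennreal b" "0 \<le> b" by (cases c) auto
  have "ennreal b \<le> ennreal (1 / 2 * b)" using c b(2) unfolding b(1) by (subst ennreal_mult) auto
  moreover have "0 \<le> 1 / 2 * b" using b(2) by simp
  ultimately have "b \<le> 1 / 2 * b" by (simp only: ennreal_le_iff)
  then have "b = 0" using b(2) by linarith
  then have "c = 0" using b(1) by simp
  then have "hausdorff_measure u F = 0" unfolding c_def by (rule hausdorff_measure_eq_0[OF u])
  with u show ?thesis by (intro that[of u]) simp_all
qed

lemma is_quasi_self_similar:
  obtains a K u where "quasi_self_similar F a K u"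
proof -
  obtain u where u: "0 \<le> u" "hausdorff_measure u F = 0" by (rule measure_zero)
  obtain p where p: "p \<in> F" using nontrivial by blast
  define a0 where "a0 = min 1 (m / G\<^sup>2)"
  have a0: "0 < a0" "a0 \<le> 1" using m G_ge_1 by (auto simp: a0_def)
  \<comment> \<open>The extra 2 keeps the lower ratio strictly below 1 even if \<open>a0 = 1\<close>
    and \<open>G = 1\<close>.\<close>
  have "quasi_self_similar F (a0 / (2 * G)) G u"
  proof
    show "0 < a0 / (2 * G)" "a0 / (2 * G) < 1" using a0 G_ge_1 by (auto simp: divide_less_eq)
    fix x :: 'a and r :: real assume x: "x \<in> F" and r: "0 < r" "r \<le> 1"
    obtain w where w: "set w \<subseteq> I" "x \<in> word_map w ` F" "word_scale p w \<le> r" "a0 * r \<le> word_scale p w"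
      unfolding a0_def by (rule exists_word_of_scale[OF p x r])
    have "a0 / (2 * G) * r * dist v z \<le> dist (word_map w v) (word_map w z)
        \<and> dist (word_map w v) (word_map w z) \<le> G * r * dist v z" if vz: "v \<in> F" "z \<in> F" for v z
    proof
      have "(a0 * r) * dist v z \<le> word_scale p w * dist v z" using w(4) by (rule mult_right_mono) simp
      also have "\<dots> \<le> G * dist (word_map w v) (word_map w z)" by (rule word_map_ge[OF w(1) p vz])
      also have "\<dots> \<le> (2 * G) * dist (word_map w v) (word_map w z)"
        using G_ge_1 by (intro mult_right_mono) auto
      finally have "a0 * r * dist v z / (2 * G) \<le> dist (word_map w v) (word_map w z)"
        using G_ge_1 by (simp add: pos_divide_le_eq mult.commute)
      then show "a0 / (2 * G) * r * dist v z \<le> dist (word_map w v) (word_map w z)" by simp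
      have "dist (word_map w v) (word_map w z) \<le> G * (word_scale p w * dist v z)"
        by (rule word_map_le[OF w(1) p vz])
      also have "\<dots> \<le> G * (r * dist v z)"
        using w(3) G_ge_1 by (intro mult_left_mono mult_right_mono) auto
      finally show "dist (word_map w v) (word_map w z) \<le> G * r * dist v z" by (simp add: mult.assoc)
    qed
    moreover have "word_map w ` F \<subseteq> F" using word_map_in[OF w(1)] by blast
    ultimately show "\<exists>g. g ` F \<subseteq> F \<and> x \<in> g ` F \<and>
        (\<forall>v\<in>F. \<forall>z\<in>F. a0 / (2 * G) * r * dist v z \<le> dist (g v) (g z) \<and> dist (g v) (g z) \<le> G * r * dist v z)"
      using w(2) by blast
  qed (use compact_F nontrivial G_ge_1 u in auto)
  then show ?thesis by (rule that)
qed

end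

section \<open>Conformal iterated function systems\<close>

lemma conformal_has_derivative:
  assumes "conformal_on \<Omega> \<phi>" "x \<in> \<Omega>"
  shows "(\<phi> has_derivative blinfun_apply (differential \<phi> x)) (at x)"
proof -
  have "(\<phi> has_derivative frechet_derivative \<phi> (at x)) (at x)"
    using assms unfolding conformal_on_def by (simp add: frechet_derivative_works)
  then show ?thesis unfolding differential_def
    by (simp add: bounded_linear_Blinfun_apply has_derivative_bounded_linear)
qed

lemma conformal_norm_differential_pos:
  assumes "conformal_on \<Omega> \<phi>" "x \<in> \<Omega>"
  shows "0 < norm (differential \<phi> x)"
proof -
  obtain b :: 'a where "b \<in> Basis" using nonempty_Basis by blast
  then have "b \<noteq> 0" by (rule nonzero_Basis)
  then have "norm (differential \<phi> x) * norm b \<noteq> 0"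
    using assms unfolding conformal_on_def by blast
  then show ?thesis by simp
qed

text \<open>On a convex set the mean value inequality turns the bound on the differential into a
  Lipschitz constant; the maximum with \<open>1/2\<close> keeps it positive and below 1.\<close>

lemma conformal_contracting:
  assumes \<phi>: "conformal_on \<Omega> \<phi>" and \<Omega>: "convex \<Omega>" and sup: "differential_sup_norm \<Omega> \<phi> < 1"
  obtains \<kappa> where "0 < \<kappa>" "\<kappa> < 1" "\<forall>x\<in>\<Omega>. \<forall>y\<in>\<Omega>. dist (\<phi> x) (\<phi> y) \<le> \<kappa> * dist x y"
proof -
  define k where "k = enn2real (differential_sup_norm \<Omega> \<phi>)"
  have k: "differential_sup_norm \<Omega> \<phi> = ennreal k"
    using sup by (cases "differential_sup_norm \<Omega> \<phi>") (auto simp: k_def)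
  have k1: "k < 1" using sup unfolding k by (simp add: ennreal_less_one_iff)
  have bound: "norm (differential \<phi> x) \<le> max k (1/2)" if "x \<in> \<Omega>" for x
  proof -
    have "ennreal (norm (differential \<phi> x)) \<le> ennreal k"
      unfolding k[symmetric] differential_sup_norm_def using that by (rule SUP_upper)
    also have "\<dots> \<le> ennreal (max k (1/2))" by (simp add: ennreal_leI)
    finally show ?thesis by (simp add: ennreal_le_iff2)
  qed
  have "dist (\<phi> x) (\<phi> y) \<le> max k (1/2) * dist x y" if "x \<in> \<Omega>" "y \<in> \<Omega>" for x y
    unfolding dist_norm
  proof (rule differentiable_bound[OF \<Omega> _ _ that])
    show "(\<phi> has_derivative blinfun_apply (differential \<phi> z)) (at z within \<Omega>)" if "z \<in> \<Omega>" for z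
      using conformal_has_derivative[OF \<phi> that] by (rule has_derivative_at_withinI)
    show "onorm (blinfun_apply (differential \<phi> z)) \<le> max k (1/2)" if "z \<in> \<Omega>" for z
      using bound[OF that] by (simp add: norm_blinfun.rep_eq)
  qed
  then show ?thesis using that[of "max k (1/2)"] k1 by simp
qed

text \<open>Convexity keeps the segment inside \<open>\<Omega>\<close>, where the Hoelder condition
  bounds the change of the differential. Since the differential is a similarity, its value at
  \<open>y - x\<close> has length exactly \<open>norm (differential \<phi> x) * dist x y\<close>, so
  the linearization compares distances.\<close>

lemma conformal_linearization:
  assumes \<phi>: "conformal_on \<Omega> \<phi>" and \<Omega>: "convex \<Omega>" and xy: "x \<in> \<Omega>" "y \<in> \<Omega>"
    and hoelder: "\<forall>x\<in>\<Omega>. \<forall>y\<in>\<Omega>. norm (differential \<phi> x - differential \<phi> y) \<le> c * norm (x - y) powr \<alpha>"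
    and c: "0 < c" "0 < \<alpha>"
  shows "\<bar>dist (\<phi> x) (\<phi> y) - norm (differential \<phi> x) * dist x y\<bar> \<le> c * dist x y powr \<alpha> * dist x y"
proof -
  define S where "S = closed_segment x y"
  have S: "S \<subseteq> \<Omega>" unfolding S_def using \<Omega> xy by (simp add: closed_segment_subset)
  have "norm (\<phi> y - \<phi> x - blinfun_apply (differential \<phi> x) (y - x)) \<le> norm (y - x) * (c * dist x y powr \<alpha>)"
  proof (rule differentiable_bound_linearization[where S = S and f' = "\<lambda>z. blinfun_apply (differential \<phi> z)"])
    show "x + t *\<^sub>R (y - x) \<in> S" if "t \<in> {0..1}" for t
      using that unfolding S_def closed_segment_def by (auto simp: algebra_simps intro!: exI[of _ t])
    show "(\<phi> has_derivative blinfun_apply (differential \<phi> z)) (at z within S)" if "z \<in> S" for z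
      using conformal_has_derivative[OF \<phi>] S that by (blast intro: has_derivative_at_withinI)
    show "x \<in> S" by (simp add: S_def)
    show "onorm (blinfun_apply (differential \<phi> z) - blinfun_apply (differential \<phi> x)) \<le> c * dist x y powr \<alpha>" if z: "z \<in> S" for z
    proof -
      have "dist z x \<le> dist x y" using z unfolding S_def
        by (metis dist_commute dist_in_closed_segment)
      then have "norm (z - x) powr \<alpha> \<le> dist x y powr \<alpha>" using c by (intro powr_mono2) (auto simp: dist_norm)
      then have "norm (differential \<phi> z - differential \<phi> x) \<le> c * dist x y powr \<alpha>"
        using hoelder S z xy(1) c(1) by (smt (verit) mult_left_mono subsetD)
      moreover have "blinfun_apply (differential \<phi> z) - blinfun_apply (differential \<phi> x)
          = blinfun_apply (differential \<phi> z - differential \<phi> x)"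
        by (auto simp: blinfun.diff_left)
      ultimately show ?thesis by (simp add: norm_blinfun.rep_eq)
    qed
  qed
  moreover have "norm (blinfun_apply (differential \<phi> x) (y - x)) = norm (differential \<phi> x) * norm (y - x)"
    using \<phi> xy(1) unfolding conformal_on_def by (cases "y - x = 0") (simp, blast)
  moreover have "\<bar>norm (\<phi> y - \<phi> x) - norm (blinfun_apply (differential \<phi> x) (y - x))\<bar>
      \<le> norm (\<phi> y - \<phi> x - blinfun_apply (differential \<phi> x) (y - x))"
    by (rule norm_triangle_ineq3)
  ultimately show ?thesis by (simp add: dist_norm norm_minus_commute mult_ac)
qed

text \<open>The quotient of the two distances is continuous and positive on the compact set of pairs
  at distance at least \<open>\<epsilon>\<close>, so it attains a positive minimum.\<close>

lemma inj_expanding_off_diagonal: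
  fixes F :: "'a::euclidean_space set" and \<phi> :: "'a \<Rightarrow> 'a"
  assumes F: "compact F" and cont: "continuous_on F \<phi>" and inj: "inj_on \<phi> F" and \<epsilon>: "0 < \<epsilon>"
  obtains m where "0 < m" "\<forall>x\<in>F. \<forall>y\<in>F. \<epsilon> \<le> dist x y \<longrightarrow> m * dist x y \<le> dist (\<phi> x) (\<phi> y)"
proof -
  define P where "P = (F \<times> F) \<inter> {z. \<epsilon> \<le> dist (fst z) (snd z)}"
  have "closed {z :: 'a \<times> 'a. \<epsilon> \<le> dist (fst z) (snd z)}"
    by (intro closed_Collect_le continuous_intros)
  then have P: "compact P" unfolding P_def using F by (intro compact_Int_closed compact_Times)
  have cP: "continuous_on P (\<lambda>z. dist (\<phi> (fst z)) (\<phi> (snd z)) / dist (fst z) (snd z))"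
  proof (intro continuous_on_divide continuous_on_dist)
    show "continuous_on P (\<lambda>z. \<phi> (fst z))" "continuous_on P (\<lambda>z. \<phi> (snd z))"
      by (rule continuous_on_compose2[OF cont]; auto simp: P_def intro!: continuous_intros)+
  qed (use \<epsilon> in \<open>auto simp: P_def intro!: continuous_intros\<close>)
  show ?thesis
  proof (cases "P = {}")
    case True
    then have "\<forall>x\<in>F. \<forall>y\<in>F. \<epsilon> \<le> dist x y \<longrightarrow> 1 * dist x y \<le> dist (\<phi> x) (\<phi> y)"
      by (auto simp: P_def)
    then show ?thesis using that[of 1] by simp
  next
    case False
    obtain z where z: "z \<in> P"
      "\<And>w. w \<in> P \<Longrightarrow> dist (\<phi> (fst z)) (\<phi> (snd z)) / dist (fst z) (snd z) \<le> dist (\<phi> (fst w)) (\<phi> (snd w)) / dist (fst w) (snd w)"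
      using continuous_attains_inf[OF P False cP] by blast
    define m where "m = dist (\<phi> (fst z)) (\<phi> (snd z)) / dist (fst z) (snd z)"
    have zF: "fst z \<in> F" "snd z \<in> F" "\<epsilon> \<le> dist (fst z) (snd z)" using z(1) by (auto simp: P_def)
    then have "fst z \<noteq> snd z" using \<epsilon> by auto
    moreover from this have "\<phi> (fst z) \<noteq> \<phi> (snd z)" using inj zF by (meson inj_onD)
    ultimately have "0 < m" by (simp add: m_def)
    moreover have "m * dist x y \<le> dist (\<phi> x) (\<phi> y)" if "x \<in> F" "y \<in> F" "\<epsilon> \<le> dist x y" for x y
    proof -
      have "(x, y) \<in> P" using that by (simp add: P_def)
      from z(2)[OF this] have "m \<le> dist (\<phi> x) (\<phi> y) / dist x y" by (simp add: m_def)
      moreover have "0 < dist x y" using that \<epsilon> by linarith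
      ultimately show ?thesis by (simp add: pos_le_divide_eq)
    qed
    ultimately show ?thesis using that by blast
  qed
qed

text \<open>The differential gives the lower bound near the diagonal, injectivity with compactness
  gives it far away; the two regimes meet at distance \<open>\<epsilon>\<close>.\<close>

lemma conformal_expanding:
  assumes \<phi>: "conformal_on \<Omega> \<phi>" and \<Omega>: "convex \<Omega>" and inj: "inj_on \<phi> \<Omega>"
    and F: "compact F" "F \<subseteq> \<Omega>" "F \<noteq> {}"
  obtains m where "0 < m" "\<forall>x\<in>F. m \<le> norm (differential \<phi> x)"
    "\<forall>x\<in>F. \<forall>y\<in>F. m * dist x y \<le> dist (\<phi> x) (\<phi> y)"
proof -
  obtain \<alpha> c where c: "0 < c" "0 < \<alpha>" and
    h: "\<forall>x\<in>\<Omega>. \<forall>y\<in>\<Omega>. norm (differential \<phi> x - differential \<phi> y) \<le> c * norm (x - y) powr \<alpha>"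
    using \<phi> unfolding conformal_on_def by blast
  have "continuous_on F (\<lambda>x. norm (differential \<phi> x))"
    using \<phi> F(2) unfolding conformal_on_def by (blast intro: continuous_on_norm continuous_on_subset)
  then obtain z where z: "z \<in> F" "\<And>x. x \<in> F \<Longrightarrow> norm (differential \<phi> z) \<le> norm (differential \<phi> x)"
    using continuous_attains_inf[OF F(1,3)] by blast
  define m1 where "m1 = norm (differential \<phi> z)"
  have m1: "0 < m1" unfolding m1_def using conformal_norm_differential_pos[OF \<phi>] z(1) F(2) by blast
  \<comment> \<open>Solves \<open>c * \<epsilon> powr \<alpha> = m1 / 2\<close>: up to this distance
    the linearization error uses up at most half of the derivative term.\<close>
  define \<epsilon> where "\<epsilon> = (m1 / (2 * c)) powr (1 / \<alpha>)"
  have \<epsilon>: "0 < \<epsilon>" using m1 c by (simp add: \<epsilon>_def)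
  have near: "m1 / 2 * dist x y \<le> dist (\<phi> x) (\<phi> y)" if xy: "x \<in> F" "y \<in> F" "dist x y \<le> \<epsilon>" for x y
  proof -
    have "dist x y powr \<alpha> \<le> \<epsilon> powr \<alpha>" using xy c by (intro powr_mono2) auto
    also have "\<dots> = m1 / (2 * c)" using c m1 by (simp add: \<epsilon>_def powr_powr)
    finally have "c * dist x y powr \<alpha> \<le> m1 / 2" using c by (simp add: field_simps)
    then have "c * dist x y powr \<alpha> * dist x y \<le> m1 / 2 * dist x y" by (rule mult_right_mono) simp
    moreover have "\<bar>dist (\<phi> x) (\<phi> y) - norm (differential \<phi> x) * dist x y\<bar> \<le> c * dist x y powr \<alpha> * dist x y"
      by (rule conformal_linearization[OF \<phi> \<Omega> _ _ h c]) (use xy F(2) in auto)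
    moreover have "m1 * dist x y \<le> norm (differential \<phi> x) * dist x y"
      unfolding m1_def using z(2)[OF xy(1)] by (rule mult_right_mono) simp
    ultimately show ?thesis by (simp add: abs_le_iff)
  qed
  have "continuous_on F \<phi>"
    using conformal_has_derivative[OF \<phi>] F(2) by (meson continuous_at_imp_continuous_on has_derivative_continuous subsetD)
  then obtain m2 where m2: "0 < m2" "\<forall>x\<in>F. \<forall>y\<in>F. \<epsilon> \<le> dist x y \<longrightarrow> m2 * dist x y \<le> dist (\<phi> x) (\<phi> y)"
    using inj_expanding_off_diagonal[OF F(1) _ inj_on_subset[OF inj F(2)] \<epsilon>] by blast
  define m where "m = min (m1 / 2) m2"
  have "m * dist x y \<le> dist (\<phi> x) (\<phi> y)" if xy: "x \<in> F" "y \<in> F" for x y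
  proof -
    have "m * dist x y \<le> m1 / 2 * dist x y" "m * dist x y \<le> m2 * dist x y"
      unfolding m_def by (intro mult_right_mono; simp)+
    then show ?thesis using near[OF xy] m2(2) xy by (meson linear order_trans)
  qed
  moreover have "0 < m" using m1 m2 by (simp add: m_def)
  moreover have "m \<le> norm (differential \<phi> x)" if "x \<in> F" for x
  proof -
    have "m1 \<le> norm (differential \<phi> x)" using z(2)[OF that] by (simp add: m1_def)
    moreover have "m \<le> m1 / 2" by (simp add: m_def)
    ultimately show ?thesis using m1 by linarith
  qed
  ultimately show ?thesis using that by blast
qed

text \<open>The additive error becomes multiplicative because both compared lengths are at least
  \<open>m * dist x y\<close>, together with 1 + v \<le> exp v. The factor 2 collects the
  linearization error at \<open>x\<close> and the change of the differential from \<open>x\<close>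
  to \<open>z\<close>.\<close>

lemma conformal_distortion:
  assumes \<phi>: "conformal_on \<Omega> \<phi>" and \<Omega>: "convex \<Omega>" and F: "F \<subseteq> \<Omega>"
    and hoelder: "\<forall>x\<in>\<Omega>. \<forall>y\<in>\<Omega>. norm (differential \<phi> x - differential \<phi> y) \<le> c * norm (x - y) powr \<alpha>"
    and c: "0 < c" "0 < \<alpha>"
    and m: "0 < m" "\<forall>x\<in>F. m \<le> norm (differential \<phi> x)" "\<forall>x\<in>F. \<forall>y\<in>F. m * dist x y \<le> dist (\<phi> x) (\<phi> y)"
    and xyz: "x \<in> F" "y \<in> F" "z \<in> F" and \<delta>: "dist x y \<le> \<delta>" "dist x z \<le> \<delta>"
  shows "dist (\<phi> x) (\<phi> y) \<le> norm (differential \<phi> z) * dist x y * exp (2 * c / m * \<delta> powr \<alpha>) \<and>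
    norm (differential \<phi> z) * dist x y \<le> dist (\<phi> x) (\<phi> y) * exp (2 * c / m * \<delta> powr \<alpha>)"
proof -
  define d where "d = dist x y"
  define q where "q = dist (\<phi> x) (\<phi> y)"
  define l where "l = norm (differential \<phi> z)"
  define t where "t = c * \<delta> powr \<alpha>"
  have inO: "x \<in> \<Omega>" "y \<in> \<Omega>" "z \<in> \<Omega>" using xyz F by auto
  have d: "0 \<le> d" by (simp add: d_def)
  have t: "0 \<le> t" using c by (simp add: t_def)
  have mono: "c * b powr \<alpha> \<le> t" if "0 \<le> b" "b \<le> \<delta>" for b
    unfolding t_def using that c by (intro mult_left_mono powr_mono2) auto
  have "\<bar>q - norm (differential \<phi> x) * d\<bar> \<le> c * d powr \<alpha> * d"
    unfolding q_def d_def by (rule conformal_linearization[OF \<phi> \<Omega> inO(1,2) hoelder c])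
  also have "\<dots> \<le> t * d" using mono[OF d] \<delta>(1) d by (intro mult_right_mono) (auto simp: d_def)
  finally have 1: "\<bar>q - norm (differential \<phi> x) * d\<bar> \<le> t * d" .
  have "\<bar>norm (differential \<phi> x) - l\<bar> \<le> norm (differential \<phi> x - differential \<phi> z)"
    unfolding l_def by (rule norm_triangle_ineq3)
  also have "\<dots> \<le> c * norm (x - z) powr \<alpha>" using hoelder inO by blast
  also have "\<dots> \<le> t" using \<delta>(2) by (intro mono) (auto simp: dist_norm)
  finally have "\<bar>norm (differential \<phi> x) - l\<bar> * d \<le> t * d" using d by (rule mult_right_mono)
  then have 2: "\<bar>norm (differential \<phi> x) * d - l * d\<bar> \<le> t * d"
    using d by (simp add: abs_mult left_diff_distrib[symmetric])
  have 3: "\<bar>q - l * d\<bar> \<le> 2 * t * d" using 1 2 by linarith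
  have exp: "b + 2 * t * d \<le> b * exp (2 * c / m * \<delta> powr \<alpha>)" if b: "m * d \<le> b" for b
  proof -
    have "0 \<le> b" using b m(1) d by (meson mult_nonneg_nonneg less_imp_le order_trans)
    have "2 * t * d = 2 * t / m * (m * d)" using m(1) by simp
    also have "\<dots> \<le> 2 * t / m * b" using b t m(1) by (intro mult_left_mono) auto
    finally have "b + 2 * t * d \<le> b * (1 + 2 * t / m)" by (simp add: algebra_simps)
    also have "\<dots> \<le> b * exp (2 * t / m)" using \<open>0 \<le> b\<close> exp_ge_add_one_self by (rule mult_left_mono[rotated])
    finally show ?thesis by (simp add: t_def mult.assoc)
  qed
  have "m * d \<le> q" using m(3) xyz by (simp add: q_def d_def)
  moreover have "m * d \<le> l * d" using m(2) xyz d by (intro mult_right_mono) (auto simp: l_def)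
  ultimately show ?thesis using exp[of q] exp[of "l * d"] 3
    unfolding q_def[symmetric] l_def[symmetric] d_def[symmetric] by linarith
qed

lemma self_conformal_imp_quasi_self_similar:
  assumes F: "self_conformal_set F" and nontrivial: "\<exists>x\<in>F. \<exists>y\<in>F. x \<noteq> y"
  obtains a K u where "quasi_self_similar F a K u"
proof -
  obtain \<Omega> N \<phi> where ifs: "conformal_ifs \<Omega> N \<phi>" and F: "F \<noteq> {}" "compact F" "F \<subseteq> \<Omega>"
    and F_eq: "F = (\<Union>i\<in>{1..N}. \<phi> i ` F)"
    using F unfolding self_conformal_set_def by blast
  have \<Omega>: "convex \<Omega>" and N: "2 \<le> N" using ifs by (auto simp: conformal_ifs_def)
  have conf: "conformal_on \<Omega> (\<phi> i)" "inj_on (\<phi> i) \<Omega>" "differential_sup_norm \<Omega> (\<phi> i) < 1"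
    if "i \<in> {1..N}" for i
    using ifs that unfolding conformal_ifs_def by blast+
  have "\<forall>i\<in>{1..N}. \<exists>k. 0 < k \<and> k < 1 \<and> (\<forall>x\<in>\<Omega>. \<forall>y\<in>\<Omega>. dist (\<phi> i x) (\<phi> i y) \<le> k * dist x y)"
    using conformal_contracting[OF conf(1) \<Omega> conf(3)] by metis
  then obtain k where k: "\<And>i. i \<in> {1..N} \<Longrightarrow> 0 < k i \<and> k i < 1 \<and> (\<forall>x\<in>\<Omega>. \<forall>y\<in>\<Omega>. dist (\<phi> i x) (\<phi> i y) \<le> k i * dist x y)"
    by metis
  have "\<forall>i\<in>{1..N}. \<exists>m. 0 < m \<and> (\<forall>x\<in>F. m \<le> norm (differential (\<phi> i) x))
      \<and> (\<forall>x\<in>F. \<forall>y\<in>F. m * dist x y \<le> dist (\<phi> i x) (\<phi> i y))"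
    using conformal_expanding[OF conf(1) \<Omega> conf(2) F(2,3,1)] by metis
  then obtain m where m: "\<And>i. i \<in> {1..N} \<Longrightarrow> 0 < m i \<and> (\<forall>x\<in>F. m i \<le> norm (differential (\<phi> i) x))
      \<and> (\<forall>x\<in>F. \<forall>y\<in>F. m i * dist x y \<le> dist (\<phi> i x) (\<phi> i y))"
    by metis
  have "\<forall>i\<in>{1..N}. \<exists>\<alpha> c. 0 < c \<and> 0 < \<alpha> \<and>
      (\<forall>x\<in>\<Omega>. \<forall>y\<in>\<Omega>. norm (differential (\<phi> i) x - differential (\<phi> i) y) \<le> c * norm (x - y) powr \<alpha>)"
    using conf(1) unfolding conformal_on_def by blast
  then obtain \<alpha> c where c: "\<And>i. i \<in> {1..N} \<Longrightarrow> 0 < c i \<and> 0 < \<alpha> i \<and>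
      (\<forall>x\<in>\<Omega>. \<forall>y\<in>\<Omega>. norm (differential (\<phi> i) x - differential (\<phi> i) y) \<le> c i * norm (x - y) powr \<alpha> i)"
    by metis
  have ne: "k ` {1..N} \<noteq> {}" "m ` {1..N} \<noteq> {}" using N by auto
  define \<kappa> where "\<kappa> = Max (k ` {1..N})"
  have k_le: "k i \<le> \<kappa>" if "i \<in> {1..N}" for i unfolding \<kappa>_def using that by (intro Max_ge) auto
  have \<kappa>: "0 < \<kappa>" "\<kappa> < 1"
  proof -
    have "\<kappa> \<in> k ` {1..N}" unfolding \<kappa>_def using ne(1) by (intro Max_in) auto
    then show "0 < \<kappa>" "\<kappa> < 1" using k by auto
  qed
  define m0 where "m0 = Min (m ` {1..N})"
  have m_ge: "m0 \<le> m i" if "i \<in> {1..N}" for i unfolding m0_def using that by (intro Min_le) auto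
  have m0: "0 < m0"
  proof -
    have "m0 \<in> m ` {1..N}" unfolding m0_def using ne(2) by (intro Min_in) auto
    then show "0 < m0" using m by auto
  qed
  define D where "D = diameter F"
  have D: "0 \<le> D" unfolding D_def using compact_imp_bounded[OF F(2)] by (rule diameter_ge_0)
  \<comment> \<open>Each map has its own constants and Hoelder exponent. The sum over
    \<open>i\<close> dominates every single error and is a finite sum of geometric sequences in
    \<open>n\<close>, hence summable.\<close>
  define e where "e n = (\<Sum>i\<in>{1..N}. 2 * c i / m i * (\<kappa> ^ n * D) powr \<alpha> i)" for n
  have "summable e" unfolding e_def
  proof (rule summable_sum)
    fix i assume i: "i \<in> {1..N}"
    have "(\<kappa> ^ n * D) powr \<alpha> i = (\<kappa> powr \<alpha> i) ^ n * D powr \<alpha> i" for n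
    proof -
      have "(\<kappa> ^ n) powr \<alpha> i = (\<kappa> powr real n) powr \<alpha> i" using \<kappa>(1) by (simp add: powr_realpow)
      also have "\<dots> = (\<kappa> powr \<alpha> i) powr real n" by (simp add: powr_powr mult.commute)
      also have "\<dots> = (\<kappa> powr \<alpha> i) ^ n" using \<kappa>(1) by (intro powr_realpow) simp
      finally show ?thesis by (simp add: powr_mult)
    qed
    moreover have "\<kappa> powr \<alpha> i < 1" using \<kappa> c[OF i] powr_less_mono2[of "\<alpha> i" \<kappa> 1] by simp
    then have "summable (\<lambda>n. (2 * c i / m i * D powr \<alpha> i) * (\<kappa> powr \<alpha> i) ^ n)"
      by (intro summable_mult summable_geometric) simp
    ultimately show "summable (\<lambda>n. 2 * c i / m i * (\<kappa> ^ n * D) powr \<alpha> i)" by (simp add: mult_ac)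
  qed
  have term_nonneg: "0 \<le> 2 * c i / m i * (\<kappa> ^ n * D) powr \<alpha> i" if "i \<in> {1..N}" for i n
    using c[OF that] m[OF that] by simp
  interpret bounded_distortion F "{1..N}" \<phi> "\<lambda>i x. norm (differential (\<phi> i) x)" \<kappa> m0 e
  proof
    fix i x y assume i: "i \<in> {1..N}" and xy: "x \<in> F" "y \<in> F"
    have "dist (\<phi> i x) (\<phi> i y) \<le> k i * dist x y" using k[OF i] xy F(3) by blast
    also have "\<dots> \<le> \<kappa> * dist x y" using k_le[OF i] by (rule mult_right_mono) simp
    finally show "dist (\<phi> i x) (\<phi> i y) \<le> \<kappa> * dist x y" .
    have "m0 * dist x y \<le> m i * dist x y" using m_ge[OF i] by (rule mult_right_mono) simp
    also have "\<dots> \<le> dist (\<phi> i x) (\<phi> i y)" using m[OF i] xy by blast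
    finally show "m0 * dist x y \<le> dist (\<phi> i x) (\<phi> i y)" .
  next
    fix i x assume "i \<in> {1..N}" "x \<in> F"
    then show "0 < norm (differential (\<phi> i) x)"
      using conformal_norm_differential_pos conf(1) F(3) by blast
  next
    fix n show "0 \<le> e n" unfolding e_def by (rule sum_nonneg) (rule term_nonneg)
  next
    fix i x y z n assume i: "i \<in> {1..N}" and xyz: "x \<in> F" "y \<in> F" "z \<in> F"
      and \<delta>: "dist x y \<le> \<kappa> ^ n * diameter F" "dist x z \<le> \<kappa> ^ n * diameter F"
    define E where "E = 2 * c i / m i * (\<kappa> ^ n * diameter F) powr \<alpha> i"
    have "E \<le> e n" unfolding e_def D_def[symmetric] E_def
      by (rule member_le_sum[of i _ "\<lambda>i. 2 * c i / m i * (\<kappa> ^ n * D) powr \<alpha> i"]) (use i term_nonneg in auto)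
    then have E: "exp E \<le> exp (e n)" by simp
    have "dist (\<phi> i x) (\<phi> i y) \<le> norm (differential (\<phi> i) z) * dist x y * exp E \<and>
      norm (differential (\<phi> i) z) * dist x y \<le> dist (\<phi> i x) (\<phi> i y) * exp E"
      unfolding E_def
      by (rule conformal_distortion[OF conf(1)[OF i] \<Omega> F(3) _ _ _ _ _ _ xyz \<delta>]) (use c[OF i] m[OF i] in blast)+
    moreover have "norm (differential (\<phi> i) z) * dist x y * exp E \<le> norm (differential (\<phi> i) z) * dist x y * exp (e n)"
      using E by (rule mult_left_mono) simp
    moreover have "dist (\<phi> i x) (\<phi> i y) * exp E \<le> dist (\<phi> i x) (\<phi> i y) * exp (e n)"
      using E by (rule mult_left_mono) simp
    ultimately show "dist (\<phi> i x) (\<phi> i y) \<le> norm (differential (\<phi> i) z) * dist x y * exp (e n) \<and>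
      norm (differential (\<phi> i) z) * dist x y \<le> dist (\<phi> i x) (\<phi> i y) * exp (e n)"
      by linarith
  qed (use F(2) nontrivial F_eq \<kappa> m0 \<open>summable e\<close> in auto)
  show ?thesis by (rule is_quasi_self_similar) (rule that)
qed

section \<open>One-point sets and the conclusion\<close>

lemma hausdorff_content_0_ge_1:
  assumes "A \<noteq> {}"
  shows "1 \<le> hausdorff_content 0 \<delta> A"
proof (rule hausdorff_content_ge)
  fix U :: "nat \<Rightarrow> 'a set" assume "A \<subseteq> (\<Union>i. U i)"
  then obtain i where "U i \<noteq> {}" using assms by blast
  then have "1 = diam_pow 0 (U i)" by (simp add: diam_pow_def)
  also have "\<dots> \<le> (\<Sum>i. diam_pow 0 (U i))"
    using sum_le_suminf[of "\<lambda>i. diam_pow 0 (U i)" "{i}"] by simp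
  finally show "1 \<le> (\<Sum>i. diam_pow 0 (U i))" .
qed

lemma hausdorff_content_singleton_le: "hausdorff_content t \<delta> {x} \<le> diam_pow t {x}"
  by (rule hausdorff_content_le_diam_pow) (simp add: ediameter_def)

text \<open>Every positive exponent gives measure 0 while exponent 0 gives a positive value, so the
  infimum 0 is not attained.\<close>

lemma hausdorff_dim_singleton: "hausdorff_dim {x::'a::euclidean_space} = 0"
proof -
  have "hausdorff_measure t {x} = 0 \<longleftrightarrow> 0 < t" if t: "0 \<le> t" for t
  proof (cases "t = 0")
    case True
    have "1 \<le> hausdorff_measure 0 {x}"
      using hausdorff_content_0_ge_1[of "{x}" "ennreal 1"] hausdorff_content_le_measure[of "ennreal 1" 0 "{x}"] by simp
    then show ?thesis using True by auto
  next
    case False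
    have "hausdorff_measure t {x} \<le> 0"
      by (rule hausdorff_measure_leI) (use hausdorff_content_singleton_le[of t _ x] False in \<open>simp add: diam_pow_def\<close>)
    then show ?thesis using False t by simp
  qed
  then have "{t. 0 \<le> t \<and> hausdorff_measure t {x} = 0} = {0<..}" by auto
  then show ?thesis unfolding hausdorff_dim_def by simp
qed

theorem theorem3p1:
  fixes F :: "'a::euclidean_space set" and s :: real
  assumes "self_conformal_set F"
    and "s = hausdorff_dim F"
  shows "(\<exists>C::real. 1 \<le> C \<and>
           (\<forall>A :: 'a set. hausdorff_measure s (F \<inter> A)
              \<le> ennreal C * hausdorff_content s \<infinity> (F \<inter> A)))
       \<and> (0 < hausdorff_measure s F \<longleftrightarrow> ahlfors_regular s F)"
proof (cases "\<exists>x\<in>F. \<exists>y\<in>F. x \<noteq> y")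
  case True
  obtain a K u where "quasi_self_similar F a K u"
    by (rule self_conformal_imp_quasi_self_similar[OF assms(1) True])
  then interpret quasi_self_similar F a K u .
  show ?thesis unfolding assms(2)
    using ratio_ge_1 measure_le_content measure_pos_imp_ahlfors_regular ahlfors_regular_imp_measure_pos
    by blast
next
  \<comment> \<open>A single point has \<open>s = 0\<close>, where the cost counts nonempty covering
    sets; the comparison then holds with \<open>C = 1\<close>.\<close>
  case False
  have "F \<noteq> {}" using assms(1) unfolding self_conformal_set_def by blast
  then obtain x where F: "F = {x}" using False by blast
  have s: "s = 0" unfolding assms(2) F by (rule hausdorff_dim_singleton)
  have le: "hausdorff_measure 0 (F \<inter> A) \<le> hausdorff_content 0 \<infinity> (F \<inter> A)" for A
  proof (cases "x \<in> A")
    case True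
    then have FA: "F \<inter> A = {x}" using F by auto
    have "hausdorff_measure 0 {x} \<le> 1"
      by (rule hausdorff_measure_leI) (use hausdorff_content_singleton_le[of 0 _ x] in \<open>simp add: diam_pow_def\<close>)
    also have "1 \<le> hausdorff_content 0 \<infinity> {x}" by (rule hausdorff_content_0_ge_1) simp
    finally show ?thesis unfolding FA .
  next
    case False
    then have "F \<inter> A = {}" using F by auto
    then show ?thesis by simp
  qed
  have "1 \<le> hausdorff_content 0 (ennreal 1) F" by (rule hausdorff_content_0_ge_1) (simp add: F)
  also have "\<dots> \<le> hausdorff_measure 0 F" by (rule hausdorff_content_le_measure) simp
  finally have "0 < hausdorff_measure 0 F" by (rule order_less_le_trans[rotated]) simp
  moreover have "ahlfors_regular 0 F"
  proof -
    \<comment> \<open>A one-point set has diameter 0, so there is no radius to test, and the zero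
      measure is Radon and concentrated on \<open>F\<close>.\<close>
    define \<mu> where "\<mu> = null_measure (borel :: 'a measure)"
    have "radon_measure \<mu>" by (rule finite_borel_measure_radon) (auto simp: \<mu>_def)
    moreover have "AE y in \<mu>. y \<in> F"
      by (rule AE_I[of _ _ UNIV]) (auto simp: \<mu>_def)
    moreover have "\<not> (0 < r \<and> ennreal r < ediameter F)" for r by (simp add: F ediameter_def)
    ultimately show ?thesis unfolding ahlfors_regular_def by (metis order_refl)
  qed
  ultimately show ?thesis unfolding s using le by (auto intro!: exI[of _ 1])
qed

end
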